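(* The Lie algebra $\mathfrak g$ of infinitesimal symmetries of the three dimensional Euler equations of gas dynamics (the system (E) given in the context) is spanned by the 13 vector fields $$\begin{aligned} X_1&=\partial_x,\quad X_2=\partial_y,\quad X_3=\partial_z,\quad X_4=\partial_t,\\ X_5&=t\,\partial_x+\partial_u,\quad X_6=t\,\partial_y+\partial_v,\quad X_7=t\,\partial_z+\partial_w,\\ X_8&=t\,\partial_t-u\,\partial_u-v\,\partial_v-w\,\partial_w+2q\,\partial_q,\\ X_9&=x\,\partial_x+y\,\partial_y+z\,\partial_z+u\,\partial_u+v\,\partial_v+w\,\partial_w-2q\,\partial_q,\\ X_{10}&=y\,\partial_x-x\,\partial_y+v\,\partial_u-u\,\partial_v,\\ X_{11}&=-z\,\partial_y+y\,\partial_z-w\,\partial_v+v\,\partial_w,\\ X_{12}&=-z\,\partial_x+x\,\partial_z-w\,\partial_u+u\,\partial_w,\\ X_{13}&=q\,\partial_q+p\,\partial_p. \end{aligned}$$ These infinitesimal symmetries generate a Lie algebra $\mathfrak g$ over the field of real or complex numbers, whose commutators $[X_i,X_j]=X_iX_j-X_jX_i$ are as follows: for $i<j$ the nonzero brackets are $$\begin{aligned} &[X_1,X_9]=X_1,\ [X_1,X_{10}]=-X_2,\ [X_1,X_{12}]=X_3,\\ &[X_2,X_9]=X_2,\ [X_2,X_{10}]=X_1,\ [X_2,X_{11}]=X_3,\\ &[X_3,X_9]=X_3,\ [X_3,X_{11}]=-X_2,\ [X_3,X_{12}]=-X_1,\\ &[X_4,X_5]=X_1,\ [X_4,X_6]=X_2,\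 [X_4,X_7]=X_3,\ [X_4,X_8]=X_4,\\ &[X_5,X_8]=-X_5,\ [X_5,X_9]=X_5,\ [X_5,X_{10}]=-X_6,\ [X_5,X_{12}]=X_7,\\ &[X_6,X_8]=-X_6,\ [X_6,X_9]=X_6,\ [X_6,X_{10}]=X_5,\ [X_6,X_{11}]=X_7,\\ &[X_7,X_8]=-X_7,\ [X_7,X_9]=X_7,\ [X_7,X_{11}]=-X_6,\ [X_7,X_{12}]=-X_5,\\ &[X_{10},X_{11}]=-X_{12},\ [X_{10},X_{12}]=X_{11},\ [X_{11},X_{12}]=-X_{10}, \end{aligned}$$ and all other brackets with $i<j$ vanish.
   Context: The system (E), for unknown functions $u,v,w$ (velocity components), $p$ (pressure), $q$ (density) of the independent variables $(t,x,y,z)$, with $\gamma\in\mathbb R$ the adiabatic index, is $$\begin{aligned} &u_t+uu_x+vu_y+wu_z+\tfrac1q p_x=0,\\ &v_t+uv_x+vv_y+wv_z+\tfrac1q p_y=0,\\ &w_t+uw_x+vw_y+ww_z+\tfrac1q p_z=0,\\ &q_t+q(u_x+v_y+w_z)+uq_x+vq_y+wq_z=0,\\ &p_t+\gamma p(u_x+v_y+w_z)+up_x+vp_y+wp_z=0. \end{aligned}$$ An infinitesimal symmetry is a vector field $X=\xi_1\partial_t+\xi_2\partial_x+\xi_3\partial_y+\xi_4\partial_z+\eta_1\partial_u+\eta_2\partial_v+\eta_3\partial_w+\eta_4\partial_p+\eta_5\partial_q$, whose coefficients are real-valued $C^\infty$ functions of $(t,x,y,z,u,v,w,p,q)$, that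 generates a one-parameter (local) Lie group of transformations leaving the system invariant, i.e. whose prolongation is tangent to the submanifold of jet space defined by the system (Lie point symmetry).
   Formalization: That the 13 fields span all infinitesimal symmetries is proved only for γ ≠ 0 and γ ≠ 5/3: for γ = 0 the field ∂_p, and for γ = 5/3 a projective field beginning t²∂_t, is a further symmetry; all other claims hold for every real γ. *)

theory Defs
  imports "HOL-Analysis.Analysis" "HOL-Library.Function_Algebras"
begin

section \<open>Smooth functions\<close>

text \<open>The definitions of this section are meant for open subsets of finite-dimensional spaces.\<close>

fun Ck_on :: "nat \<Rightarrow> 'a::real_normed_vector set \<Rightarrow> ('a \<Rightarrow> 'b::real_normed_vector) \<Rightarrow> bool" where
  "Ck_on 0 S f \<longleftrightarrow> continuous_on S f"
| "Ck_on (Suc k) S f \<longleftrightarrow>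
     (\<forall>x\<in>S. f differentiable at x) \<and> (\<forall>v. Ck_on k S (\<lambda>x. frechet_derivative f (at x) v))"

definition smooth_on :: "'a::real_normed_vector set \<Rightarrow> ('a \<Rightarrow> 'b::real_normed_vector) \<Rightarrow> bool" where
  "smooth_on S f \<longleftrightarrow> (\<forall>k. Ck_on k S f)"


section \<open>Vector fields over a field of scalars\<close>

text \<open>
  A vector field on a domain \<open>M\<close> of \<open>\<real>\<^sup>n\<close> with coefficients in \<open>'k\<close> (the real or the complex
  numbers) is a total function that vanishes outside \<open>M\<close>, so that equality of functions is equality
  on \<open>M\<close> and the fields on \<open>M\<close> form a subspace of the function space.
\<close>

type_synonym ('k, 'n) vfield = "(real, 'n) vec \<Rightarrow> ('k, 'n) vec"

definition vf_scale :: "'k::field \<Rightarrow> ('k, 'n) vfield \<Rightarrow> ('k, 'n::finite) vfield" where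
  "vf_scale c X = (\<lambda>b. c *s X b)"

interpretation vf: vector_space vf_scale
  by unfold_locales
    (auto simp: vf_scale_def fun_eq_iff vec_eq_iff algebra_simps)

definition on_domain :: "(real, 'n::finite) vec set \<Rightarrow> ('k::zero, 'n) vfield \<Rightarrow> ('k, 'n) vfield" where
  "on_domain M X = (\<lambda>b. if b \<in> M then X b else 0)"

definition pderiv_at :: "'n \<Rightarrow> ((real, 'n) vec \<Rightarrow> 'k::real_normed_vector) \<Rightarrow> (real, 'n::finite) vec \<Rightarrow> 'k" where
  "pderiv_at a f b = frechet_derivative f (at b) (axis a 1)"

definition vf_apply ::
  "('k::real_normed_field, 'n::finite) vfield \<Rightarrow> ((real, 'n) vec \<Rightarrow> 'k) \<Rightarrow> (real, 'n) vec \<Rightarrow> 'k" where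
  "vf_apply X f b = (\<Sum>a\<in>UNIV. X b $ a * pderiv_at a f b)"

text \<open>
  The commutator \<open>X Y - Y X\<close> of derivations; its component \<open>a\<close> is its value on the \<open>a\<close>-th
  coordinate function \<open>x\<^sub>a\<close>, and \<open>Y x\<^sub>a\<close> is the \<open>a\<close>-th component of \<open>Y\<close>.
\<close>

definition lie_bracket ::
  "(real, 'n) vec set \<Rightarrow> ('k::real_normed_field, 'n::finite) vfield \<Rightarrow> ('k, 'n) vfield \<Rightarrow> ('k, 'n) vfield" where
  "lie_bracket M X Y =
     on_domain M (\<lambda>b. \<chi> a. vf_apply X (\<lambda>b'. Y b' $ a) b - vf_apply Y (\<lambda>b'. X b' $ a) b)"

definition lie_algebra ::
  "('k::field \<Rightarrow> 'v \<Rightarrow> 'v) \<Rightarrow> ('v \<Rightarrow> 'v \<Rightarrow> 'v) \<Rightarrow> 'v::ab_group_add set \<Rightarrow> bool" where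
  "lie_algebra s br L \<longleftrightarrow>
     vector_space s \<and> module.subspace s L \<and>
     (\<forall>X\<in>L. \<forall>Y\<in>L. br X Y \<in> L) \<and>
     (\<forall>X\<in>L. \<forall>Y\<in>L. \<forall>Z\<in>L.
        br (X + Y) Z = br X Z + br Y Z \<and> br X (Y + Z) = br X Y + br X Z) \<and>
     (\<forall>c. \<forall>X\<in>L. \<forall>Y\<in>L. br (s c X) Y = s c (br X Y) \<and> br X (s c Y) = s c (br X Y)) \<and>
     (\<forall>X\<in>L. br X X = 0) \<and>
     (\<forall>X\<in>L. \<forall>Y\<in>L. \<forall>Z\<in>L. br X (br Y Z) + br Y (br Z X) + br Z (br X Y) = 0)"


section \<open>Lie point symmetries of first-order systems\<close>

text \<open>
  With independent variables \<open>x\<^sub>i\<close> (\<open>i :: 'i\<close>) and dependent variables \<open>u\<^sub>d\<close> (\<open>d :: 'd\<close>), the base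
  space has coordinates indexed by \<open>'i + 'd\<close>, and a first-order jet is a pair \<open>(b, j)\<close> of a base
  point and the matrix of first derivatives, \<open>j $ d $ i\<close> being the coordinate \<open>\<partial>u\<^sub>d/\<partial>x\<^sub>i\<close>.
\<close>

type_synonym ('i, 'd) base_point = "(real, 'i + 'd) vec"
type_synonym ('i, 'd) jet = "('i, 'd) base_point \<times> ((real, 'i) vec, 'd) vec"

definition total_deriv ::
  "'i \<Rightarrow> (('i::finite, 'd::finite) base_point \<Rightarrow> real) \<Rightarrow> ('i, 'd) jet \<Rightarrow> real" where
  "total_deriv i f = (\<lambda>(b, j).
     pderiv_at (Inl i) f b + (\<Sum>d\<in>UNIV. j $ d $ i * pderiv_at (Inr d) f b))"

definition prolong ::
  "(real, 'i::finite + 'd::finite) vfield \<Rightarrow> ('i, 'd) jet \<Rightarrow> ('i, 'd) jet" where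
  "prolong X = (\<lambda>(b, j).
     (X b,
      \<chi> d i. total_deriv i (\<lambda>b'. X b' $ Inr d) (b, j)
             - (\<Sum>k\<in>UNIV. j $ d $ k * total_deriv i (\<lambda>b'. X b' $ Inl k) (b, j))))"

definition tangent_vector :: "'a::real_normed_vector set \<Rightarrow> 'a \<Rightarrow> 'a \<Rightarrow> bool" where
  "tangent_vector S a v \<longleftrightarrow>
     (\<exists>c. c 0 = a \<and> (\<forall>\<^sub>F s in nhds (0::real). c s \<in> S) \<and> (c has_vector_derivative v) (at 0))"

text \<open>\<open>S\<close> is the submanifold of jets over \<open>M\<close> that is defined by the system.\<close>

definition infinitesimal_symmetries ::
  "('i::finite, 'd::finite) base_point set \<Rightarrow> ('i, 'd) jet set \<Rightarrow> (real, 'i + 'd) vfield set" where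
  "infinitesimal_symmetries M S =
     {X. smooth_on M X \<and> (\<forall>b. b \<notin> M \<longrightarrow> X b = 0) \<and> (\<forall>J\<in>S. tangent_vector S J (prolong X J))}"


section \<open>The Euler equations of gas dynamics\<close>

datatype euler_indep = ct | cx | cy | cz
datatype euler_dep = cu | cv | cw | cp | cq

instance euler_indep :: finite
proof
  have "(UNIV :: euler_indep set) \<subseteq> {ct, cx, cy, cz}"
    using euler_indep.exhaust by blast
  then show "finite (UNIV :: euler_indep set)" by (rule finite_subset) simp
qed

instance euler_dep :: finite
proof
  have "(UNIV :: euler_dep set) \<subseteq> {cu, cv, cw, cp, cq}"
    using euler_dep.exhaust by blast
  then show "finite (UNIV :: euler_dep set)" by (rule finite_subset) simp
qed

type_synonym euler_point = "(euler_indep, euler_dep) base_point"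
type_synonym euler_jet = "(euler_indep, euler_dep) jet"
type_synonym 'k euler_vfield = "('k, euler_indep + euler_dep) vfield"

text \<open>The density \<open>q\<close> is a denominator, so the jets with \<open>q = 0\<close> are excluded.\<close>

definition euler_manifold :: "real \<Rightarrow> euler_point set \<Rightarrow> euler_jet set" where
  "euler_manifold \<gamma> M = {(b, j).
     let u = b $ Inr cu; v = b $ Inr cv; w = b $ Inr cw; p = b $ Inr cp; q = b $ Inr cq;
         du = j $ cu; dv = j $ cv; dw = j $ cw; dp = j $ cp; dq = j $ cq
     in b \<in> M \<and> q \<noteq> 0 \<and>
        du $ ct + u * du $ cx + v * du $ cy + w * du $ cz + 1 / q * dp $ cx = 0 \<and>
        dv $ ct + u * dv $ cx + v * dv $ cy + w * dv $ cz + 1 / q * dp $ cy = 0 \<and>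
        dw $ ct + u * dw $ cx + v * dw $ cy + w * dw $ cz + 1 / q * dp $ cz = 0 \<and>
        dq $ ct + q * (du $ cx + dv $ cy + dw $ cz)
          + u * dq $ cx + v * dq $ cy + w * dq $ cz = 0 \<and>
        dp $ ct + \<gamma> * p * (du $ cx + dv $ cy + dw $ cz)
          + u * dp $ cx + v * dp $ cy + w * dp $ cz = 0}"

definition euler_symmetries :: "real \<Rightarrow> euler_point set \<Rightarrow> real euler_vfield set" where
  "euler_symmetries \<gamma> M = infinitesimal_symmetries M (euler_manifold \<gamma> M)"

definition euler_generator :: "euler_point set \<Rightarrow> nat \<Rightarrow> 'k::real_normed_field euler_vfield" where
  "euler_generator M i = on_domain M (\<lambda>b.
     let t = of_real (b $ Inl ct); x = of_real (b $ Inl cx);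
         y = of_real (b $ Inl cy); z = of_real (b $ Inl cz);
         u = of_real (b $ Inr cu); v = of_real (b $ Inr cv); w = of_real (b $ Inr cw);
         p = of_real (b $ Inr cp); q = of_real (b $ Inr cq);
         Dt = axis (Inl ct) 1; Dx = axis (Inl cx) 1; Dy = axis (Inl cy) 1; Dz = axis (Inl cz) 1;
         Du = axis (Inr cu) 1; Dv = axis (Inr cv) 1; Dw = axis (Inr cw) 1;
         Dp = axis (Inr cp) 1; Dq = axis (Inr cq) 1
     in [Dx,
         Dy,
         Dz,
         Dt,
         t *s Dx + Du,
         t *s Dy + Dv,
         t *s Dz + Dw,
         t *s Dt - u *s Du - v *s Dv - w *s Dw + (2 * q) *s Dq,
         x *s Dx + y *s Dy + z *s Dz + u *s Du + v *s Dv + w *s Dw - (2 * q) *s Dq,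
         y *s Dx - x *s Dy + v *s Du - u *s Dv,
         - (z *s Dy) + y *s Dz - w *s Dv + v *s Dw,
         - (z *s Dx) + x *s Dz - w *s Du + u *s Dw,
         q *s Dq + p *s Dp] ! (i - 1))"

text \<open>An entry \<open>((i, j), (s, k))\<close> encodes \<open>[X\<^sub>i, X\<^sub>j] = s X\<^sub>k\<close>; pairs without an entry commute.\<close>

definition euler_commutators :: "((nat \<times> nat) \<times> (int \<times> nat)) list" where
  "euler_commutators =
    [((1, 9), (1, 1)), ((1, 10), (-1, 2)), ((1, 12), (1, 3)),
     ((2, 9), (1, 2)), ((2, 10), (1, 1)), ((2, 11), (1, 3)),
     ((3, 9), (1, 3)), ((3, 11), (-1, 2)), ((3, 12), (-1, 1)),
     ((4, 5), (1, 1)), ((4, 6), (1, 2)), ((4, 7), (1, 3)), ((4, 8), (1, 4)),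
     ((5, 8), (-1, 5)), ((5, 9), (1, 5)), ((5, 10), (-1, 6)), ((5, 12), (1, 7)),
     ((6, 8), (-1, 6)), ((6, 9), (1, 6)), ((6, 10), (1, 5)), ((6, 11), (1, 7)),
     ((7, 8), (-1, 7)), ((7, 9), (1, 7)), ((7, 11), (-1, 6)), ((7, 12), (-1, 5)),
     ((10, 11), (-1, 12)), ((10, 12), (1, 11)), ((11, 12), (-1, 10))]"

definition generate_euler_algebra :: "euler_point set \<Rightarrow> (nat \<Rightarrow> 'k::real_normed_field euler_vfield) \<Rightarrow> bool" where
  "generate_euler_algebra M X \<longleftrightarrow>
     lie_algebra vf_scale (lie_bracket M) (vf.span (X ` {1..13})) \<and>
     inj_on X {1..13} \<and> vf.independent (X ` {1..13}) \<and>
     (\<forall>i\<in>{1..13}. \<forall>j\<in>{1..13}. i < j \<longrightarrow>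
        lie_bracket M (X i) (X j) =
          (case map_of euler_commutators (i, j) of
             None \<Rightarrow> 0
           | Some (s, k) \<Rightarrow> vf_scale (of_int s) (X k)))"

end

theory Submission
  imports Defs
begin

text \<open>
  The equations are solved for the time derivatives, so the manifold is a graph over the base points
  and the spatial derivatives, and \<open>(\<beta>, \<kappa>)\<close> is tangent at a jet exactly when it annihilates the
  linearized equations. For a symmetry these are polynomial identities of degree two in fifteen free
  spatial derivatives. The quadratic part of the density equation shows that the coefficients \<open>\<xi>\<close>
  of \<open>\<partial>\<^sub>t, \<partial>\<^sub>x, \<partial>\<^sub>y, \<partial>\<^sub>z\<close> do not depend on \<open>u, v, w, p, q\<close>; the linear parts give
  \<open>\<xi>\<^sub>0 = \<xi>\<^sub>0(t)\<close>, \<open>\<eta>\<^sub>k = \<partial>\<^sub>t\<xi>\<^sub>k + \<Sum>\<^sub>m u\<^sub>m\<partial>\<^sub>m\<xi>\<^sub>k - u\<^sub>k\<partial>\<^sub>t\<xi>\<^sub>0\<close>, a pressure coefficient \<open>p P\<close>, a density coefficient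
  \<open>q (2\<partial>\<^sub>t\<xi>\<^sub>0 + P - 2\<lambda>)\<close> and the conformal Killing equation \<open>\<partial>\<^sub>i\<xi>\<^sub>m + \<partial>\<^sub>m\<xi>\<^sub>i = 2\<lambda>\<delta>\<^sub>i\<^sub>m\<close>.
  Together with the terms of degree zero this makes \<open>\<lambda>\<close> and \<open>P\<close> functions of \<open>t\<close>
  alone with \<open>(5 - 3\<gamma>) \<lambda>' = 0\<close>; hence all second derivatives of the coefficients vanish where
  \<open>p q \<noteq> 0\<close>, by continuity on all of \<open>M\<close>, and the field is affine with 13 free parameters.
  The Lie algebra is computed in these parameters, where the bracket is bilinear.
\<close>

section \<open>Smooth functions and partial derivatives\<close>

lemma pderiv_at_has_derivative:
  assumes "(f has_derivative f') (at b)"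
  shows "pderiv_at a f b = f' (axis a 1)"
  by (simp add: pderiv_at_def frechet_derivative_at[OF assms, symmetric])

text \<open>\<open>frechet_derivative\<close> is a choice among all derivatives at the point, and
  which maps qualify depends only on the germ; the identity thus also covers points where neither
  map is differentiable.\<close>

lemma frechet_derivative_cong_open:
  assumes "open S" "x \<in> S" "\<And>y. y \<in> S \<Longrightarrow> f y = g y"
  shows "frechet_derivative f (at x) = frechet_derivative g (at x)"
proof -
  have "(f has_derivative D) (at x) \<longleftrightarrow> (g has_derivative D) (at x)" for D
    using has_derivative_transform_within_open[of f D x UNIV S g]
      has_derivative_transform_within_open[of g D x UNIV S f] assms by auto
  then show ?thesis by (simp add: frechet_derivative_def)
qed

lemma pderiv_at_cong_open:
  assumes "open S" "b \<in> S" "\<And>y. y \<in> S \<Longrightarrow> f y = g y"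
  shows "pderiv_at a f b = pderiv_at a g b"
  unfolding pderiv_at_def using frechet_derivative_cong_open[OF assms] by simp

lemma differentiable_cong_open:
  assumes "open S" "x \<in> S" "\<And>y. y \<in> S \<Longrightarrow> f y = g y"
  shows "f differentiable at x \<longleftrightarrow> g differentiable at x"
  unfolding differentiable_def
  using has_derivative_transform_within_open[of f _ x UNIV S g]
      has_derivative_transform_within_open[of g _ x UNIV S f] assms by auto

lemma Ck_on_cong:
  assumes "open S" "\<And>x. x \<in> S \<Longrightarrow> f x = g x"
  shows "Ck_on k S f \<longleftrightarrow> Ck_on k S g"
  using assms(2)
proof (induction k arbitrary: f g)
  case 0
  then show ?case by (simp cong: continuous_on_cong)
next
  case (Suc k)
  have "f differentiable at x \<longleftrightarrow> g differentiable at x" if "x \<in> S" for x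
    using differentiable_cong_open[OF assms(1) that Suc.prems] .
  moreover have "Ck_on k S (\<lambda>x. frechet_derivative f (at x) v) \<longleftrightarrow>
      Ck_on k S (\<lambda>x. frechet_derivative g (at x) v)" for v
    using frechet_derivative_cong_open[OF assms(1) _ Suc.prems] by (intro Suc.IH) simp
  ultimately show ?case by simp
qed

text \<open>Applied to coordinate projections, this gives smoothness of the components of a vector
  field.\<close>

lemma Ck_on_bounded_linear:
  assumes "open S" "bounded_linear h" "Ck_on k S f"
  shows "Ck_on k S (\<lambda>x. h (f x))"
  using assms(3)
proof (induction k arbitrary: f)
  case 0
  then show ?case by (simp add: bounded_linear.continuous_on[OF assms(2)])
next
  case (Suc k)
  have D: "((\<lambda>x. h (f x)) has_derivative (\<lambda>v. h (frechet_derivative f (at x) v))) (at x)"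
    if "x \<in> S" for x
    using Suc.prems that
    by (auto simp: frechet_derivative_works intro!: bounded_linear.has_derivative[OF assms(2)])
  have "Ck_on k S (\<lambda>x. frechet_derivative (\<lambda>x. h (f x)) (at x) v)" for v
  proof (rule Ck_on_cong[OF assms(1), THEN iffD2])
    show "Ck_on k S (\<lambda>x. h (frechet_derivative f (at x) v))"
      using Suc by simp
  qed (simp add: frechet_derivative_at[OF D, symmetric])
  then show ?case using D by (auto simp: differentiable_def)
qed

lemma Ck_on_const: "Ck_on k S (\<lambda>x. c)"
  by (induction k arbitrary: c) auto

text \<open>The derivative in direction \<open>v\<close> is the constant \<open>h v\<close>, and
  constants lie in every class \<open>Ck_on\<close>. The formula for \<open>f\<close> is required on
  \<open>S\<close> only, which suits fields that are cut off outside a domain.\<close>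

lemma smooth_on_affine:
  assumes "open S" "bounded_linear h" "\<And>x. x \<in> S \<Longrightarrow> f x = h x + c"
  shows "smooth_on S f"
proof -
  have D: "(f has_derivative h) (at x)" if "x \<in> S" for x
  proof -
    have "((\<lambda>x. h x + c) has_derivative h) (at x)"
      using bounded_linear_imp_has_derivative[OF assms(2)] by (auto intro!: derivative_eq_intros)
    then show ?thesis
      using has_derivative_transform_within_open[of "\<lambda>x. h x + c" h x UNIV S f] assms that by auto
  qed
  have "Ck_on k S (\<lambda>x. frechet_derivative f (at x) v)" for k v
    by (rule Ck_on_cong[OF assms(1), THEN iffD2, OF _ Ck_on_const])
      (simp add: frechet_derivative_at[OF D, symmetric])
  moreover have "f differentiable at x" if "x \<in> S" for x
    using D[OF that] by (auto simp: differentiable_def)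
  moreover from this have "continuous_on S f"
    by (intro continuous_at_imp_continuous_on ballI differentiable_imp_continuous_within)
  ultimately have "Ck_on k S f" for k by (cases k) auto
  then show ?thesis by (simp add: smooth_on_def)
qed

lemma smooth_on_component:
  "open S \<Longrightarrow> smooth_on S X \<Longrightarrow> smooth_on S (\<lambda>b. X b $ i)"
  unfolding smooth_on_def using Ck_on_bounded_linear[OF _ bounded_linear_vec_nth] by blast

lemma Ck_on_subset: "Ck_on k S f \<Longrightarrow> T \<subseteq> S \<Longrightarrow> Ck_on k T f"
  by (induction k arbitrary: f) (auto intro: continuous_on_subset)

lemma smooth_on_subset: "smooth_on S f \<Longrightarrow> T \<subseteq> S \<Longrightarrow> smooth_on T f"
  by (auto simp: smooth_on_def intro: Ck_on_subset)

lemma smooth_on_differentiable: "smooth_on S f \<Longrightarrow> x \<in> S \<Longrightarrow> f differentiable at x"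
  by (auto simp: smooth_on_def dest: spec[of _ "Suc 0"])

lemma smooth_on_continuous: "smooth_on S f \<Longrightarrow> continuous_on S f"
  by (auto simp: smooth_on_def dest: spec[of _ 0])

lemma smooth_on_frechet_derivative:
  "smooth_on S f \<Longrightarrow> smooth_on S (\<lambda>x. frechet_derivative f (at x) v)"
  unfolding smooth_on_def
proof
  fix k assume "\<forall>k. Ck_on k S f"
  then have "Ck_on (Suc k) S f" ..
  then show "Ck_on k S (\<lambda>x. frechet_derivative f (at x) v)" by simp
qed

lemma smooth_on_pderiv: "smooth_on S f \<Longrightarrow> smooth_on S (pderiv_at a f)"
  unfolding pderiv_at_def by (rule smooth_on_frechet_derivative)

text \<open>The mean value theorem, applied first along \<open>v\<close> and then along \<open>w\<close>, expresses the second
  difference over a parallelogram by a second derivative at an intermediate point.\<close>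

lemma second_difference_mean_value:
  fixes f :: "'a::real_normed_vector \<Rightarrow> real"
  assumes "smooth_on S f" "0 < h"
    and sub: "\<And>s r. 0 \<le> s \<Longrightarrow> s \<le> h \<Longrightarrow> 0 \<le> r \<Longrightarrow> r \<le> h \<Longrightarrow> b + s *\<^sub>R v + r *\<^sub>R w \<in> S"
  shows "\<exists>s r. 0 < s \<and> s < h \<and> 0 < r \<and> r < h \<and>
    f (b + h *\<^sub>R v + h *\<^sub>R w) - f (b + h *\<^sub>R v) - f (b + h *\<^sub>R w) + f b =
    h\<^sup>2 * frechet_derivative (\<lambda>x. frechet_derivative f (at x) v) (at (b + s *\<^sub>R v + r *\<^sub>R w)) w"
proof -
  have line: "((\<lambda>s. g (c + s *\<^sub>R d)) has_field_derivative
      frechet_derivative g (at (c + s *\<^sub>R d)) d) (at s)"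
    if "smooth_on S g" "c + s *\<^sub>R d \<in> S" for g :: "'a \<Rightarrow> real" and c d s
  proof -
    let ?D = "frechet_derivative g (at (c + s *\<^sub>R d))"
    have "(g has_derivative ?D) (at (c + s *\<^sub>R d))"
      using smooth_on_differentiable[OF that] frechet_derivative_works by blast
    moreover have "((\<lambda>s. c + s *\<^sub>R d) has_derivative (\<lambda>t. t *\<^sub>R d)) (at s)"
      by (auto intro!: derivative_eq_intros)
    ultimately have "((\<lambda>s. g (c + s *\<^sub>R d)) has_derivative (\<lambda>t. ?D (t *\<^sub>R d))) (at s)"
      using has_derivative_compose by blast
    moreover have "?D (t *\<^sub>R d) = t * ?D d" for t
      using linear_frechet_derivative[OF smooth_on_differentiable[OF that]]
      by (simp add: linear_cmul)
    ultimately show ?thesis by (simp add: has_field_derivative_def mult_commute_abs)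
  qed
  define g where "g s = f (b + h *\<^sub>R w + s *\<^sub>R v) - f (b + s *\<^sub>R v)" for s
  define g' where "g' s = frechet_derivative f (at (b + h *\<^sub>R w + s *\<^sub>R v)) v
     - frechet_derivative f (at (b + s *\<^sub>R v)) v" for s
  have "(g has_field_derivative g' s) (at s)" if "0 \<le> s" "s \<le> h" for s
    unfolding g_def g'_def using sub[OF that, of h] sub[OF that, of 0] assms
    by (intro DERIV_diff line) (auto simp: algebra_simps)
  then obtain s where s: "0 < s" "s < h" "g h - g 0 = h * g' s"
    using MVT2[OF assms(2), of g g'] by (metis diff_zero)
  define k where "k r = frechet_derivative f (at ((b + s *\<^sub>R v) + r *\<^sub>R w)) v" for r
  define k' where "k' r = frechet_derivative (\<lambda>x. frechet_derivative f (at x) v)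
     (at ((b + s *\<^sub>R v) + r *\<^sub>R w)) w" for r
  have "(k has_field_derivative k' r) (at r)" if "0 \<le> r" "r \<le> h" for r
    unfolding k_def k'_def using sub[of s r] that s assms(1)
    by (intro line smooth_on_frechet_derivative) auto
  then obtain r where r: "0 < r" "r < h" "k h - k 0 = h * k' r"
    using MVT2[OF assms(2), of k k'] by (metis diff_zero)
  have "g' s = k h - k 0"
    by (simp add: g'_def k_def algebra_simps)
  with s r have "g h - g 0 = h\<^sup>2 * k' r" by (simp add: power2_eq_square)
  moreover have "g h - g 0 =
      f (b + h *\<^sub>R v + h *\<^sub>R w) - f (b + h *\<^sub>R v) - f (b + h *\<^sub>R w) + f b"
    by (simp add: g_def algebra_simps)
  ultimately show ?thesis using s r by (auto simp: k'_def)
qed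

text \<open>Over one small parallelogram at \<open>b\<close> the second difference is the squared
  side parameter times either mixed derivative, each taken at some intermediate point. Continuity of
  both at \<open>b\<close> makes them agree there.\<close>

lemma frechet_derivative_commute:
  fixes f :: "'a::real_normed_vector \<Rightarrow> real"
  assumes "open S" "smooth_on S f" "b \<in> S"
  shows "frechet_derivative (\<lambda>x. frechet_derivative f (at x) v) (at b) w =
         frechet_derivative (\<lambda>x. frechet_derivative f (at x) w) (at b) v"
    (is "?F v w b = ?F w v b")
proof -
  have cont: "isCont (?F v w) b" for v w
    using smooth_on_continuous[OF smooth_on_frechet_derivative[OF smooth_on_frechet_derivative[OF assms(2)]]]
      assms(1,3) by (simp add: continuous_on_eq_continuous_at)
  have "\<bar>?F v w b - ?F w v b\<bar> < e + e" if "e > 0" for e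
  proof -
    have ev: "\<exists>d>0. \<forall>x. dist x b < d \<longrightarrow> dist (?F v w x) (?F v w b) < e" for v w
      using cont[of v w] that unfolding continuous_at_eps_delta by blast
    obtain d1 where d1: "d1 > 0" "\<And>x. dist x b < d1 \<Longrightarrow> dist (?F v w x) (?F v w b) < e"
      using ev[of v w] by blast
    obtain d2 where d2: "d2 > 0" "\<And>x. dist x b < d2 \<Longrightarrow> dist (?F w v x) (?F w v b) < e"
      using ev[of w v] by blast
    obtain d3 where d3: "d3 > 0" "ball b d3 \<subseteq> S"
      using assms(1,3) openE by blast
    define d where "d = min d1 (min d2 d3)"
    have d: "d > 0" using d1 d2 d3 by (simp add: d_def)
    \<comment> \<open>This size keeps the whole parallelogram closer than \<open>d\<close> to
      \<open>b\<close>; the summand 1 keeps the denominator positive when both directions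
      vanish.\<close>
    define h where "h = d / (2 * (norm v + norm w + 1))"
    have n: "norm v + norm w + 1 > 0" by (simp add: add_nonneg_pos)
    then have h: "h > 0" using d by (simp add: h_def)
    have near: "dist (b + s *\<^sub>R v + r *\<^sub>R w) b < d" if "0 \<le> s" "s \<le> h" "0 \<le> r" "r \<le> h" for s r
    proof -
      have "norm (s *\<^sub>R v + r *\<^sub>R w) \<le> s * norm v + r * norm w"
        using norm_triangle_ineq[of "s *\<^sub>R v" "r *\<^sub>R w"] that by simp
      also have "\<dots> \<le> h * norm v + h * norm w"
        using that by (intro add_mono mult_right_mono) auto
      also have "\<dots> < h * (norm v + norm w + 1)" using h by (simp add: algebra_simps)
      also have "\<dots> = d / 2" using n by (simp add: h_def divide_simps)
      finally show ?thesis using d by (simp add: dist_norm add.assoc)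
    qed
    have near': "dist (b + s *\<^sub>R w + r *\<^sub>R v) b < d" if "0 \<le> s" "s \<le> h" "0 \<le> r" "r \<le> h" for s r
      using near[of r s] that by (simp add: algebra_simps)
    have S: "x \<in> S" if "dist x b < d" for x
      using that d3 by (auto simp: d_def dist_commute)
    let ?\<Delta> = "f (b + h *\<^sub>R v + h *\<^sub>R w) - f (b + h *\<^sub>R v) - f (b + h *\<^sub>R w) + f b"
    obtain s r where 1: "0 < s" "s < h" "0 < r" "r < h" "?\<Delta> = h\<^sup>2 * ?F v w (b + s *\<^sub>R v + r *\<^sub>R w)"
      using second_difference_mean_value[OF assms(2) h, of b v w] near S by blast
    obtain s' r' where 2: "0 < s'" "s' < h" "0 < r'" "r' < h"
        "f (b + h *\<^sub>R w + h *\<^sub>R v) - f (b + h *\<^sub>R w) - f (b + h *\<^sub>R v) + f b =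
          h\<^sup>2 * ?F w v (b + s' *\<^sub>R w + r' *\<^sub>R v)"
      using second_difference_mean_value[OF assms(2) h, of b w v] near' S by blast
    have "h\<^sup>2 * ?F v w (b + s *\<^sub>R v + r *\<^sub>R w) = h\<^sup>2 * ?F w v (b + s' *\<^sub>R w + r' *\<^sub>R v)"
      using 1(5) 2(5) by (simp add: algebra_simps)
    then have "?F v w (b + s *\<^sub>R v + r *\<^sub>R w) = ?F w v (b + s' *\<^sub>R w + r' *\<^sub>R v)"
      using h by simp
    moreover have "dist (?F v w (b + s *\<^sub>R v + r *\<^sub>R w)) (?F v w b) < e"
      using 1 near[of s r] by (intro d1(2)) (simp add: d_def)
    moreover have "dist (?F w v (b + s' *\<^sub>R w + r' *\<^sub>R v)) (?F w v b) < e"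
      using 2 near'[of s' r'] by (intro d2(2)) (simp add: d_def)
    ultimately show ?thesis by (simp add: dist_real_def)
  qed
  \<comment> \<open>If the two values differed, half of their distance would be an admissible
    \<open>e\<close>, and the distance would be strictly below itself.\<close>
  from this[of "\<bar>?F v w b - ?F w v b\<bar> / 2"] show ?thesis by fastforce
qed

lemma pderiv_at_commute:
  fixes f :: "(real, 'n::finite) vec \<Rightarrow> real"
  assumes "open S" "smooth_on S f" "b \<in> S"
  shows "pderiv_at a (pderiv_at c f) b = pderiv_at c (pderiv_at a f) b"
  unfolding pderiv_at_def using frechet_derivative_commute[OF assms] .

section \<open>Rules for partial derivatives\<close>

lemma has_derivative_vec_nth_at: "((\<lambda>x. x $ i) has_derivative (\<lambda>h. h $ i)) (at b)"
  by (rule bounded_linear_imp_has_derivative) (rule bounded_linear_vec_nth)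

lemma differentiable_vec_nth_at [simp]: "(\<lambda>x. x $ i) differentiable at b"
  using has_derivative_vec_nth_at by (auto simp: differentiable_def)

lemma pderiv_at_const [simp]: "pderiv_at a (\<lambda>_. k) b = 0"
  by (simp add: pderiv_at_def)

lemma pderiv_at_coord [simp]: "pderiv_at a (\<lambda>x. x $ i) b = of_bool (i = a)"
  by (simp add: pderiv_at_has_derivative[OF has_derivative_vec_nth_at] axis_def)

context
  fixes f g :: "(real, 'n::finite) vec \<Rightarrow> real" and b
  assumes f: "f differentiable at b" and g: "g differentiable at b"
begin

lemma pderiv_at_add: "pderiv_at a (\<lambda>x. f x + g x) b = pderiv_at a f b + pderiv_at a g b"
  using pderiv_at_has_derivative[OF has_derivative_add[OF f[unfolded frechet_derivative_works]
      g[unfolded frechet_derivative_works]]] by (simp add: pderiv_at_def)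

lemma pderiv_at_diff: "pderiv_at a (\<lambda>x. f x - g x) b = pderiv_at a f b - pderiv_at a g b"
  using pderiv_at_has_derivative[OF has_derivative_diff[OF f[unfolded frechet_derivative_works]
      g[unfolded frechet_derivative_works]]] by (simp add: pderiv_at_def)

lemma pderiv_at_mult:
  "pderiv_at a (\<lambda>x. f x * g x) b = f b * pderiv_at a g b + pderiv_at a f b * g b"
  using pderiv_at_has_derivative[OF has_derivative_mult[OF f[unfolded frechet_derivative_works]
      g[unfolded frechet_derivative_works]]] by (simp add: pderiv_at_def)

end

lemmas pderiv_at_arith = pderiv_at_add pderiv_at_diff pderiv_at_mult

lemma frechet_derivative_eq_sum_pderiv:
  fixes f :: "(real, 'n::finite) vec \<Rightarrow> real"
  assumes "f differentiable at b"
  shows "frechet_derivative f (at b) h = (\<Sum>a\<in>UNIV. h $ a * pderiv_at a f b)"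
proof -
  let ?D = "frechet_derivative f (at b)"
  have lin: "linear ?D"
    by (rule linear_frechet_derivative[OF assms])
  have "h = (\<Sum>a\<in>UNIV. (h $ a) *\<^sub>R axis a 1)"
    by (simp add: vec_eq_iff axis_def if_distrib cong: if_cong)
  then have "?D h = ?D (\<Sum>a\<in>UNIV. (h $ a) *\<^sub>R axis a 1)"
    by simp
  also have "\<dots> = (\<Sum>a\<in>UNIV. h $ a * pderiv_at a f b)"
    by (simp add: linear_sum[OF lin] linear_cmul[OF lin] pderiv_at_def)
  finally show ?thesis .
qed

lemma constant_if_pderiv_zero:
  fixes f :: "(real, 'n::finite) vec \<Rightarrow> real"
  assumes "open M" "connected M" "\<And>b. b \<in> M \<Longrightarrow> f differentiable at b"
    "\<And>a b. b \<in> M \<Longrightarrow> pderiv_at a f b = 0" "x \<in> M" "y \<in> M"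
  shows "f x = f y"
proof (rule has_derivative_zero_unique_connected[OF assms(1,2) _ assms(5,6)])
  fix b assume b: "b \<in> M"
  then have "frechet_derivative f (at b) = (\<lambda>h. 0)"
    by (simp add: fun_eq_iff frechet_derivative_eq_sum_pderiv assms)
  with assms(3)[OF b] show "(f has_derivative (\<lambda>h. 0)) (at b)"
    by (simp add: frechet_derivative_works)
qed

section \<open>Tangent vectors of the Euler manifold\<close>

definition material :: "euler_point \<Rightarrow> real ^ euler_indep \<Rightarrow> real" where
  "material b f = f $ ct + b $ Inr cu * f $ cx + b $ Inr cv * f $ cy + b $ Inr cw * f $ cz"

text \<open>The derivative of \<open>material\<close> in the velocities: the time derivative carries
  no velocity factor and drops out.\<close>

definition advect :: "euler_point \<Rightarrow> real ^ euler_indep \<Rightarrow> real" where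
  "advect b f = b $ Inr cu * f $ cx + b $ Inr cv * f $ cy + b $ Inr cw * f $ cz"

definition flow_div :: "real ^ euler_indep ^ euler_dep \<Rightarrow> real" where
  "flow_div j = j $ cu $ cx + j $ cv $ cy + j $ cw $ cz"

text \<open>The index \<open>d\<close> labels the equation that contains the time derivative of the
  dependent variable \<open>d\<close>, with coefficient 1.\<close>

definition euler_residual ::
  "real \<Rightarrow> euler_point \<Rightarrow> real ^ euler_indep ^ euler_dep \<Rightarrow> euler_dep \<Rightarrow> real" where
  "euler_residual \<gamma> b j d = material b (j $ d) +
     (case d of
        cu \<Rightarrow> j $ cp $ cx / b $ Inr cq
      | cv \<Rightarrow> j $ cp $ cy / b $ Inr cq
      | cw \<Rightarrow> j $ cp $ cz / b $ Inr cq
      | cp \<Rightarrow> \<gamma> * b $ Inr cp * flow_div j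
      | cq \<Rightarrow> b $ Inr cq * flow_div j)"

text \<open>The directional derivative of \<open>euler_residual\<close> at \<open>(b, j)\<close>
  along \<open>(\<beta>, \<kappa>)\<close>; see
  \<open>has_field_derivative_euler_residual\<close>.\<close>

definition euler_linearized ::
  "real \<Rightarrow> euler_point \<Rightarrow> real ^ euler_indep ^ euler_dep \<Rightarrow>
   euler_point \<Rightarrow> real ^ euler_indep ^ euler_dep \<Rightarrow> euler_dep \<Rightarrow> real" where
  "euler_linearized \<gamma> b j \<beta> \<kappa> d = material b (\<kappa> $ d) + advect \<beta> (j $ d) +
     (case d of
        cu \<Rightarrow> \<kappa> $ cp $ cx / b $ Inr cq - \<beta> $ Inr cq * j $ cp $ cx / (b $ Inr cq)\<^sup>2
      | cv \<Rightarrow> \<kappa> $ cp $ cy / b $ Inr cq - \<beta> $ Inr cq * j $ cp $ cy / (b $ Inr cq)\<^sup>2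
      | cw \<Rightarrow> \<kappa> $ cp $ cz / b $ Inr cq - \<beta> $ Inr cq * j $ cp $ cz / (b $ Inr cq)\<^sup>2
      | cp \<Rightarrow> \<gamma> * (b $ Inr cp * flow_div \<kappa> + \<beta> $ Inr cp * flow_div j)
      | cq \<Rightarrow> b $ Inr cq * flow_div \<kappa> + \<beta> $ Inr cq * flow_div j)"

lemma all_euler_dep: "(\<forall>d. P d) \<longleftrightarrow> P cu \<and> P cv \<and> P cw \<and> P cp \<and> P cq"
  by (metis euler_dep.exhaust)

lemma euler_manifold_iff:
  "(b, j) \<in> euler_manifold \<gamma> M \<longleftrightarrow>
     b \<in> M \<and> b $ Inr cq \<noteq> 0 \<and> (\<forall>d. euler_residual \<gamma> b j d = 0)"
  by (auto simp: euler_manifold_def Let_def all_euler_dep euler_residual_def material_def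
      flow_div_def algebra_simps)

lemma has_field_derivative_euler_residual:
  assumes B: "\<And>a. ((\<lambda>s. B s $ a) has_field_derivative \<beta> $ a) (at s)"
    and J: "\<And>d i. ((\<lambda>s. J s $ d $ i) has_field_derivative \<kappa> $ d $ i) (at s)"
    and q: "B s $ Inr cq \<noteq> 0"
  shows "((\<lambda>s. euler_residual \<gamma> (B s) (J s) d) has_field_derivative
    euler_linearized \<gamma> (B s) (J s) \<beta> \<kappa> d) (at s)"
  using q
  by (cases d) (auto simp: euler_residual_def euler_linearized_def material_def advect_def
      flow_div_def field_simps power2_eq_square intro!: derivative_eq_intros B J)

lemma has_field_derivative_vec_nth:
  assumes "(f has_vector_derivative f') (at s)"
  shows "((\<lambda>s. f s $ a) has_field_derivative f' $ a) (at s)"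
  using bounded_linear.has_vector_derivative[OF bounded_linear_vec_nth assms]
  by (simp add: has_real_derivative_iff_has_vector_derivative)

lemma has_vector_derivative_vec_nth:
  assumes "(f has_vector_derivative f') (at s)"
  shows "((\<lambda>s. f s $ a) has_vector_derivative f' $ a) (at s)"
  using bounded_linear.has_vector_derivative[OF bounded_linear_vec_nth assms] .

lemma has_vector_derivative_vec_lambda:
  fixes f :: "real \<Rightarrow> 'a::euclidean_space ^ 'n"
  assumes "\<And>a. ((\<lambda>s. f s $ a) has_vector_derivative f' $ a) (at s)"
  shows "(f has_vector_derivative f') (at s)"
  unfolding has_vector_derivative_def
proof (subst has_derivative_componentwise_within, safe)
  fix i :: "'a ^ 'n" assume "i \<in> Basis"
  then obtain a u where i: "i = axis a u" by (auto simp: Basis_vec_def)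
  have "((\<lambda>s. f s $ a \<bullet> u) has_derivative (\<lambda>t. (t *\<^sub>R (f' $ a)) \<bullet> u)) (at s)"
    using assms[of a] unfolding has_vector_derivative_def
    by (rule bounded_linear.has_derivative[OF bounded_linear_inner_left])
  then show "((\<lambda>s. f s \<bullet> i) has_derivative (\<lambda>t. (t *\<^sub>R f') \<bullet> i)) (at s)"
    by (simp add: i inner_axis)
qed

text \<open>Along a curve in the manifold the residuals vanish near 0, hence so do their derivatives
  at 0. Conversely, a solution of the linearized equations is realized by a line corrected in the
  time derivatives.\<close>

lemma tangent_vector_euler_manifold:
  assumes "open M" and J: "(b, j) \<in> euler_manifold \<gamma> M"
  shows "tangent_vector (euler_manifold \<gamma> M) (b, j) (\<beta>, \<kappa>) \<longleftrightarrow>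
    (\<forall>d. euler_linearized \<gamma> b j \<beta> \<kappa> d = 0)"
proof
  assume "tangent_vector (euler_manifold \<gamma> M) (b, j) (\<beta>, \<kappa>)"
  then obtain c where c: "c 0 = (b, j)" "\<forall>\<^sub>F s in nhds 0. c s \<in> euler_manifold \<gamma> M"
    and "(c has_vector_derivative (\<beta>, \<kappa>)) (at 0)"
    unfolding tangent_vector_def by blast
  then have der: "((\<lambda>s. fst (c s)) has_vector_derivative \<beta>) (at 0)"
      "((\<lambda>s. snd (c s)) has_vector_derivative \<kappa>) (at 0)"
    using bounded_linear.has_vector_derivative[OF bounded_linear_fst]
      bounded_linear.has_vector_derivative[OF bounded_linear_snd] by fastforce+
  show "\<forall>d. euler_linearized \<gamma> b j \<beta> \<kappa> d = 0"
  proof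
    fix d
    let ?r = "\<lambda>s. euler_residual \<gamma> (fst (c s)) (snd (c s)) d"
    have "fst (c 0) $ Inr cq \<noteq> 0"
      using J by (simp add: c euler_manifold_iff)
    then have "(?r has_field_derivative euler_linearized \<gamma> b j \<beta> \<kappa> d) (at 0)"
      using has_field_derivative_euler_residual[of "\<lambda>s. fst (c s)" \<beta> 0 "\<lambda>s. snd (c s)" \<kappa> \<gamma> d]
        has_field_derivative_vec_nth[OF der(1)]
        has_field_derivative_vec_nth[OF has_vector_derivative_vec_nth[OF der(2)]]
      by (simp add: c)
    moreover have "\<forall>\<^sub>F s in nhds 0. ?r s = 0"
      using c(2) by eventually_elim (metis euler_manifold_iff prod.collapse)
    then have "(?r has_field_derivative 0) (at 0)"
      using DERIV_cong_ev[of 0 0 ?r "\<lambda>_. 0" 0] by simp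
    ultimately show "euler_linearized \<gamma> b j \<beta> \<kappa> d = 0"
      by (rule DERIV_unique)
  qed
next
  assume lin: "\<forall>d. euler_linearized \<gamma> b j \<beta> \<kappa> d = 0"
  let ?M = "euler_manifold \<gamma> M"
  have b: "b \<in> M" "b $ Inr cq \<noteq> 0" "\<And>d. euler_residual \<gamma> b j d = 0"
    using J by (auto simp: euler_manifold_iff)
  \<comment> \<open>The equations are solved for the time derivatives, so the straight line through \<open>(b, j)\<close>
    is moved into the manifold by subtracting the residuals from these coordinates.\<close>
  define B where "B s = b + s *\<^sub>R \<beta>" for s
  define K where "K s = j + s *\<^sub>R \<kappa>" for s
  define C where
    "C s = (\<chi> d i. K s $ d $ i - (if i = ct then euler_residual \<gamma> (B s) (K s) d else 0))" for s
  have DB: "(B has_vector_derivative \<beta>) (at 0)"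
    unfolding B_def by (auto intro!: derivative_eq_intros)
  have DK: "(K has_vector_derivative \<kappa>) (at 0)"
    unfolding K_def by (auto intro!: derivative_eq_intros)
  have 0: "B 0 = b" "K 0 = j" by (simp_all add: B_def K_def)
  \<comment> \<open>The correction has derivative zero at 0 because the linearized equations hold,
    so the corrected curve keeps the velocity \<kappa>.\<close>
  have DR: "((\<lambda>s. euler_residual \<gamma> (B s) (K s) d) has_field_derivative 0) (at 0)" for d
    using has_field_derivative_euler_residual[of B \<beta> 0 K \<kappa> \<gamma> d] lin b
      has_field_derivative_vec_nth[OF DB]
      has_field_derivative_vec_nth[OF has_vector_derivative_vec_nth[OF DK]]
    by (simp add: 0)
  have DC: "(C has_vector_derivative \<kappa>) (at 0)"
  proof (intro has_vector_derivative_vec_lambda)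
    fix d i
    have "((\<lambda>s. K s $ d $ i - (if i = ct then euler_residual \<gamma> (B s) (K s) d else 0))
        has_field_derivative \<kappa> $ d $ i) (at 0)"
      using DR[of d] has_field_derivative_vec_nth[OF has_vector_derivative_vec_nth[OF DK], of d i]
      by (cases "i = ct") (auto intro!: derivative_eq_intros)
    then show "((\<lambda>s. C s $ d $ i) has_vector_derivative \<kappa> $ d $ i) (at 0)"
      by (simp add: C_def has_real_derivative_iff_has_vector_derivative)
  qed
  have "((\<lambda>s. (B s, C s)) has_vector_derivative (\<beta>, \<kappa>)) (at 0)"
    by (intro has_vector_derivative_Pair DB DC)
  moreover have "(B 0, C 0) = (b, j)"
    by (simp add: C_def 0 b vec_eq_iff)
  moreover have "\<forall>\<^sub>F s in nhds 0. (B s, C s) \<in> ?M"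
  proof -
    \<comment> \<open>Each residual contains its own time derivative with coefficient 1 and no other
      one, so subtracting the residual from it cancels exactly.\<close>
    have zero: "euler_residual \<gamma> (B s) (C s) d = 0" for s d
      by (cases d) (auto simp: euler_residual_def C_def material_def flow_div_def)
    have "isCont B 0"
      using DB has_vector_derivative_continuous by blast
    then have "filterlim B (nhds (B 0)) (nhds 0)"
      unfolding isCont_def tendsto_at_iff_tendsto_nhds .
    then have lim: "filterlim B (nhds b) (nhds 0)" by (simp add: 0)
    have "open (M \<inter> {x. x $ Inr cq \<noteq> 0})"
      using assms(1) by (intro open_Int open_Collect_neq continuous_intros)
    then have "\<forall>\<^sub>F x in nhds b. x \<in> M \<inter> {x. x $ Inr cq \<noteq> 0}"
      using b by (intro eventually_nhds_in_open) auto
    from eventually_compose_filterlim[OF this lim] show ?thesis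
      by eventually_elim (simp add: euler_manifold_iff zero)
  qed
  ultimately show "tangent_vector ?M (b, j) (\<beta>, \<kappa>)"
    unfolding tangent_vector_def by (intro exI[of _ "\<lambda>s. (B s, C s)"]) simp
qed

section \<open>Linear combinations of the generators\<close>

text \<open>\<open>c i\<close> is the coefficient of the i-th generator. The linear part is kept
  apart from \<open>euler_const\<close> because its values at unit vectors are the partial
  derivatives of the field.\<close>

fun euler_lin ::
  "(nat \<Rightarrow> 'k::real_normed_field) \<Rightarrow> euler_point \<Rightarrow> euler_indep + euler_dep \<Rightarrow> 'k" where
  "euler_lin c b (Inl ct) = c 8 * of_real (b $ Inl ct)"
| "euler_lin c b (Inl cx) = c 5 * of_real (b $ Inl ct) + c 9 * of_real (b $ Inl cx)
     + c 10 * of_real (b $ Inl cy) - c 12 * of_real (b $ Inl cz)"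
| "euler_lin c b (Inl cy) = c 6 * of_real (b $ Inl ct) + c 9 * of_real (b $ Inl cy)
     - c 10 * of_real (b $ Inl cx) - c 11 * of_real (b $ Inl cz)"
| "euler_lin c b (Inl cz) = c 7 * of_real (b $ Inl ct) + c 9 * of_real (b $ Inl cz)
     + c 11 * of_real (b $ Inl cy) + c 12 * of_real (b $ Inl cx)"
| "euler_lin c b (Inr cu) = (c 9 - c 8) * of_real (b $ Inr cu)
     + c 10 * of_real (b $ Inr cv) - c 12 * of_real (b $ Inr cw)"
| "euler_lin c b (Inr cv) = (c 9 - c 8) * of_real (b $ Inr cv)
     - c 10 * of_real (b $ Inr cu) - c 11 * of_real (b $ Inr cw)"
| "euler_lin c b (Inr cw) = (c 9 - c 8) * of_real (b $ Inr cw)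
     + c 11 * of_real (b $ Inr cv) + c 12 * of_real (b $ Inr cu)"
| "euler_lin c b (Inr cp) = c 13 * of_real (b $ Inr cp)"
| "euler_lin c b (Inr cq) = (2 * c 8 - 2 * c 9 + c 13) * of_real (b $ Inr cq)"

fun euler_const :: "(nat \<Rightarrow> 'k::zero) \<Rightarrow> euler_indep + euler_dep \<Rightarrow> 'k" where
  "euler_const c (Inl ct) = c 4"
| "euler_const c (Inl cx) = c 1"
| "euler_const c (Inl cy) = c 2"
| "euler_const c (Inl cz) = c 3"
| "euler_const c (Inr cu) = c 5"
| "euler_const c (Inr cv) = c 6"
| "euler_const c (Inr cw) = c 7"
| "euler_const c (Inr cp) = 0"
| "euler_const c (Inr cq) = 0"

definition euler_comb ::
  "euler_point set \<Rightarrow> (nat \<Rightarrow> 'k::real_normed_field) \<Rightarrow> 'k euler_vfield" where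
  "euler_comb M c = on_domain M (\<lambda>b. \<chi> a. euler_lin c b a + euler_const c a)"

lemma all_euler_indep: "(\<forall>i. P i) \<longleftrightarrow> P ct \<and> P cx \<and> P cy \<and> P cz"
  by (metis euler_indep.exhaust)

lemma all_euler_coord:
  "(\<forall>a::euler_indep + euler_dep. P a) \<longleftrightarrow> P (Inl ct) \<and> P (Inl cx) \<and> P (Inl cy) \<and> P (Inl cz) \<and>
     P (Inr cu) \<and> P (Inr cv) \<and> P (Inr cw) \<and> P (Inr cp) \<and> P (Inr cq)"
  by (simp add: split_sum_all all_euler_indep all_euler_dep)

lemma euler_coord_cases:
  assumes "P (Inl ct)" "P (Inl cx)" "P (Inl cy)" "P (Inl cz)"
    "P (Inr cu)" "P (Inr cv)" "P (Inr cw)" "P (Inr cp)" "P (Inr cq)"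
  shows "P a"
  using all_euler_coord[of P] assms by blast

lemma UNIV_euler_indep: "(UNIV :: euler_indep set) = {ct, cx, cy, cz}"
  using euler_indep.exhaust by blast

lemma UNIV_euler_dep: "(UNIV :: euler_dep set) = {cu, cv, cw, cp, cq}"
  using euler_dep.exhaust by blast

lemma UNIV_euler_coord:
  "(UNIV :: (euler_indep + euler_dep) set) =
     {Inl ct, Inl cx, Inl cy, Inl cz, Inr cu, Inr cv, Inr cw, Inr cp, Inr cq}"
  by (auto simp: set_eq_iff all_euler_coord)

lemma euler_indices: "{1..13} = {1, 2, 3, 4, 5, 6, 7, 8, 9, 10, 11, 12, 13::nat}"
  by (intro set_eqI) (simp only: atLeastAtMost_iff insert_iff empty_iff, presburger)

lemma euler_comb_cong:
  assumes "\<And>i. i \<in> {1..13} \<Longrightarrow> c i = d i"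
  shows "euler_comb M c = euler_comb M d"
proof -
  have "euler_lin c b a = euler_lin d b a" "euler_const c a = euler_const d a" for b a
    using assms unfolding euler_indices by (induction a rule: euler_coord_cases; simp)+
  then show ?thesis by (simp add: euler_comb_def)
qed

lemma euler_comb_add: "euler_comb M c + euler_comb M d = euler_comb M (\<lambda>i. c i + d i)"
proof -
  have "euler_lin c b a + euler_const c a + (euler_lin d b a + euler_const d a) =
      euler_lin (\<lambda>i. c i + d i) b a + euler_const (\<lambda>i. c i + d i) a" for b a
    by (induction a rule: euler_coord_cases; simp add: algebra_simps)
  then show ?thesis
    by (auto simp: euler_comb_def on_domain_def fun_eq_iff vec_eq_iff)
qed

lemma euler_comb_scale: "vf_scale k (euler_comb M c) = euler_comb M (\<lambda>i. k * c i)"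
proof -
  have "k * (euler_lin c b a + euler_const c a) =
      euler_lin (\<lambda>i. k * c i) b a + euler_const (\<lambda>i. k * c i) a" for b a
    by (induction a rule: euler_coord_cases; simp add: algebra_simps)
  then show ?thesis
    by (auto simp: euler_comb_def vf_scale_def on_domain_def fun_eq_iff vec_eq_iff)
qed

lemma euler_comb_zero: "euler_comb M (\<lambda>i. 0) = 0"
  using euler_comb_scale[of 0 M "\<lambda>i. 0"] by (simp add: vf_scale_def fun_eq_iff vec_eq_iff)

lemma euler_generator_eq_comb:
  assumes "i \<in> {1..13}"
  shows "euler_generator M i = euler_comb M (\<lambda>k. of_bool (k = i))"
  using assms unfolding euler_indices
  by (auto simp: euler_generator_def euler_comb_def on_domain_def fun_eq_iff vec_eq_iff
      all_euler_coord axis_def Let_def)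

lemma euler_comb_eq_sum:
  "euler_comb M c = (\<Sum>i\<in>{1..13}. vf_scale (c i) (euler_generator M i))"
proof -
  have "(\<Sum>i\<in>I. euler_comb M (d i)) = euler_comb M (\<lambda>k. \<Sum>i\<in>I. d i k)" if "finite I" for I d
    using that by induction (simp_all add: euler_comb_zero euler_comb_add)
  from this[of "{1..13}" "\<lambda>i k. c i * of_bool (k = i)"]
  have "(\<Sum>i\<in>{1..13}. vf_scale (c i) (euler_generator M i)) =
      euler_comb M (\<lambda>k. \<Sum>i\<in>{1..13}. c i * of_bool (k = i))"
    by (simp only: euler_generator_eq_comb euler_comb_scale finite_atLeastAtMost cong: sum.cong)
  also have "\<dots> = euler_comb M c"
    by (rule euler_comb_cong) (simp add: of_bool_def if_distrib cong: if_cong)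
  finally show ?thesis ..
qed

lemma span_euler_generators: "vf.span (euler_generator M ` {1..13}) = range (euler_comb M)"
proof
  show "range (euler_comb M) \<subseteq> vf.span (euler_generator M ` {1..13})"
    unfolding euler_comb_eq_sum
    by (intro image_subsetI vf.span_sum vf.span_scale vf.span_base imageI)
  show "vf.span (euler_generator M ` {1..13}) \<subseteq> range (euler_comb M)"
  proof (rule vf.span_minimal)
    show "euler_generator M ` {1..13} \<subseteq> range (euler_comb M)"
      by (auto simp: euler_generator_eq_comb)
    show "vf.subspace (range (euler_comb M))"
      by (intro vf.subspaceI) (auto simp: euler_comb_add euler_comb_scale
          intro: range_eqI[of _ _ "\<lambda>i. 0"] simp flip: euler_comb_zero[of M])
  qed
qed

lemma bounded_linear_euler_lin:
  fixes c :: "nat \<Rightarrow> 'k::real_normed_field"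
  shows "bounded_linear (\<lambda>b. euler_lin c b a)"
  unfolding linear_conv_bounded_linear[symmetric]
  \<comment> \<open>\<open>euler_const.cases\<close> serves as a case rule that splits on the nine
    coordinates.\<close>
  by (rule linearI; cases rule: euler_const.cases[of "(c, a)"];
      simp add: algebra_simps scaleR_conv_of_real[where 'a='k])

lemma pderiv_at_euler_comb:
  assumes "open M" "b \<in> M"
  shows "pderiv_at a (\<lambda>b'. euler_comb M c b' $ i) b = euler_lin c (axis a 1) i"
proof -
  have "((\<lambda>b'. euler_lin c b' i + euler_const c i) has_derivative (\<lambda>h. euler_lin c h i)) (at b)"
    using bounded_linear_imp_has_derivative[OF bounded_linear_euler_lin]
    by (auto intro!: derivative_eq_intros)
  from pderiv_at_has_derivative[OF this]
  show ?thesis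
    using pderiv_at_cong_open[OF assms, of "\<lambda>b'. euler_comb M c b' $ i"
        "\<lambda>b'. euler_lin c b' i + euler_const c i" a]
    by (simp add: euler_comb_def on_domain_def)
qed

text \<open>The table of commutators, extended bilinearly to coefficient vectors.\<close>

definition euler_bracket ::
  "(nat \<Rightarrow> 'k::comm_ring) \<Rightarrow> (nat \<Rightarrow> 'k) \<Rightarrow> nat \<Rightarrow> 'k" where
  "euler_bracket c d k = (let w = (\<lambda>i j. c i * d j - c j * d i) in
     [w 1 9 + w 2 10 - w 3 12 + w 4 5,
      - w 1 10 + w 2 9 - w 3 11 + w 4 6,
      w 1 12 + w 2 11 + w 3 9 + w 4 7,
      w 4 8,
      - w 5 8 + w 5 9 + w 6 10 - w 7 12,
      - w 5 10 - w 6 8 + w 6 9 - w 7 11,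
      w 5 12 + w 6 11 - w 7 8 + w 7 9,
      0,
      0,
      - w 11 12,
      w 10 12,
      - w 10 11,
      0] ! (k - 1))"

section \<open>The Lie bracket in coefficient coordinates\<close>

lemma euler_comb_nth: "b \<in> M \<Longrightarrow> euler_comb M c b $ a = euler_lin c b a + euler_const c a"
  by (simp add: euler_comb_def on_domain_def)

text \<open>Affine fields have constant partial derivatives, so in each coordinate both sides are
  affine in the base point and bilinear in \<open>c\<close> and \<open>d\<close>, and can be
  compared as polynomials.\<close>

lemma lie_bracket_euler_comb:
  assumes "open M"
  shows "lie_bracket M (euler_comb M c) (euler_comb M d) = euler_comb M (euler_bracket c d)"
proof
  fix b
  show "lie_bracket M (euler_comb M c) (euler_comb M d) b = euler_comb M (euler_bracket c d) b"
  proof (cases "b \<in> M")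
    case True
    have "(\<Sum>a\<in>UNIV. euler_comb M c b $ a * euler_lin d (axis a 1) i)
        - (\<Sum>a\<in>UNIV. euler_comb M d b $ a * euler_lin c (axis a 1) i) =
        euler_comb M (euler_bracket c d) b $ i" for i
      using True unfolding UNIV_euler_coord
      by (induction i rule: euler_coord_cases;
          simp add: euler_comb_nth euler_bracket_def axis_def algebra_simps)
    with True show ?thesis
      by (simp add: lie_bracket_def on_domain_def vf_apply_def vec_eq_iff
          pderiv_at_euler_comb[OF assms])
  qed (simp add: lie_bracket_def euler_comb_def on_domain_def)
qed

lemma euler_bracket_bilinear:
  assumes "k \<in> {1..13}"
  shows "euler_bracket c c k = 0"
    and "euler_bracket (\<lambda>i. c i + d i) e k = euler_bracket c e k + euler_bracket d e k"
    and "euler_bracket e (\<lambda>i. c i + d i) k = euler_bracket e c k + euler_bracket e d k"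
    and "euler_bracket (\<lambda>i. r * c i) d k = r * euler_bracket c d k"
    and "euler_bracket c (\<lambda>i. r * d i) k = r * euler_bracket c d k"
  using assms unfolding euler_indices
  by (elim insertE; simp add: euler_bracket_def algebra_simps)+

text \<open>On coefficient vectors the Jacobi identity is a trilinear polynomial identity, checked
  for each \<open>k\<close>.\<close>

lemma euler_bracket_Jacobi:
  assumes "k \<in> {1..13}"
  shows "euler_bracket c (euler_bracket d e) k + euler_bracket d (euler_bracket e c) k
    + euler_bracket e (euler_bracket c d) k = 0"
  using assms unfolding euler_indices
  by (elim insertE; simp add: euler_bracket_def algebra_simps)

text \<open>Every axiom is transported along \<open>euler_comb\<close>, which is linear and turns
  \<open>lie_bracket\<close> into \<open>euler_bracket\<close>.\<close>

lemma lie_algebra_euler: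
  assumes "open M"
  shows "lie_algebra vf_scale (lie_bracket M)
    (vf.span ((euler_generator M :: nat \<Rightarrow> 'k::real_normed_field euler_vfield) ` {1..13}))"
  unfolding lie_algebra_def span_euler_generators
proof (intro conjI ballI allI)
  show "vector_space (vf_scale :: 'k \<Rightarrow> 'k euler_vfield \<Rightarrow> _)"
    by (rule vf.vector_space_axioms)
  show "vf.subspace (range (euler_comb M))"
    unfolding span_euler_generators[symmetric] by (rule vf.subspace_span)
  fix X Y :: "'k euler_vfield" assume "X \<in> range (euler_comb M)" "Y \<in> range (euler_comb M)"
  then obtain c d where [simp]: "X = euler_comb M c" "Y = euler_comb M d" by auto
  note br = lie_bracket_euler_comb[OF assms] euler_comb_add euler_comb_scale
  show "lie_bracket M X Y \<in> range (euler_comb M)" by (simp add: br)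
  show "lie_bracket M X X = 0"
    by (auto simp: br euler_bracket_bilinear simp flip: euler_comb_zero[of M]
        intro!: euler_comb_cong)
  show "lie_bracket M (vf_scale k X) Y = vf_scale k (lie_bracket M X Y)"
    "lie_bracket M X (vf_scale k Y) = vf_scale k (lie_bracket M X Y)" for k
    by (auto simp: br euler_bracket_bilinear intro!: euler_comb_cong)
  fix Z :: "'k euler_vfield" assume "Z \<in> range (euler_comb M)"
  then obtain e where [simp]: "Z = euler_comb M e" by auto
  show "lie_bracket M (X + Y) Z = lie_bracket M X Z + lie_bracket M Y Z"
    "lie_bracket M X (Y + Z) = lie_bracket M X Y + lie_bracket M X Z"
    by (auto simp: br euler_bracket_bilinear intro!: euler_comb_cong)
  show "lie_bracket M X (lie_bracket M Y Z) + lie_bracket M Y (lie_bracket M Z X)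
      + lie_bracket M Z (lie_bracket M X Y) = 0"
    by (auto simp: br euler_bracket_Jacobi simp flip: euler_comb_zero[of M]
        intro!: euler_comb_cong)
qed

section \<open>Linear independence and the commutator table\<close>

lemma euler_comb_eq_0_iff:
  assumes "open M" "M \<noteq> {}"
  shows "euler_comb M c = 0 \<longleftrightarrow> (\<forall>i\<in>{1..13}. c i = 0)"
proof
  assume 0: "euler_comb M c = 0"
  obtain b where b: "b \<in> M" using assms(2) by auto
  have lin: "euler_lin c (axis a 1) i = 0" for a i
    using pderiv_at_euler_comb[OF assms(1) b, of a c i] by (simp add: 0 pderiv_at_def)
  have "euler_lin c b i + euler_const c i = 0" for i
    using fun_cong[OF 0, of b] b by (simp add: euler_comb_def on_domain_def vec_eq_iff)
  \<comment> \<open>The partial derivatives at one point determine \<open>c 5\<close> to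
    \<open>c 13\<close>; the values in the directions t, x, y, z then determine \<open>c 1\<close>
    to \<open>c 4\<close>.\<close>
  from this[of "Inl ct"] this[of "Inl cx"] this[of "Inl cy"] this[of "Inl cz"]
    lin[of "Inl ct" "Inl ct"] lin[of "Inl ct" "Inl cx"] lin[of "Inl ct" "Inl cy"]
    lin[of "Inl ct" "Inl cz"] lin[of "Inl cx" "Inl cx"] lin[of "Inl cy" "Inl cx"]
    lin[of "Inl cz" "Inl cx"] lin[of "Inl cz" "Inl cy"] lin[of "Inr cp" "Inr cp"]
  show "\<forall>i\<in>{1..13}. c i = 0"
    unfolding euler_indices by (simp add: axis_def)
next
  assume "\<forall>i\<in>{1..13}. c i = 0"
  then show "euler_comb M c = 0"
    by (subst euler_comb_zero[symmetric]) (rule euler_comb_cong, simp)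
qed

lemma smooth_on_euler_comb:
  fixes c :: "nat \<Rightarrow> real"
  assumes "open M"
  shows "smooth_on M (euler_comb M c)"
proof (rule smooth_on_affine[OF assms])
  show "bounded_linear (\<lambda>b. \<chi> a. euler_lin c b a)"
    unfolding linear_conv_bounded_linear[symmetric]
    by (intro linearI) (simp_all add: vec_eq_iff
        linear_add[OF bounded_linear.linear[OF bounded_linear_euler_lin]]
        linear_cmul[OF bounded_linear.linear[OF bounded_linear_euler_lin]])
  show "euler_comb M c b = (\<chi> a. euler_lin c b a) + (\<chi> a. euler_const c a)" if "b \<in> M" for b
    using that by (simp add: vec_eq_iff euler_comb_nth)
qed

lemma prolong_euler_comb:
  fixes c :: "nat \<Rightarrow> real"
  assumes "open M" "b \<in> M"
  shows "prolong (euler_comb M c) (b, j) = (euler_comb M c b, \<chi> d i.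
    euler_lin c (axis (Inl i) 1) (Inr d)
      + (\<Sum>e\<in>UNIV. j $ e $ i * euler_lin c (axis (Inr e) 1) (Inr d))
      - (\<Sum>k\<in>UNIV. j $ d $ k * (euler_lin c (axis (Inl i) 1) (Inl k)
          + (\<Sum>e\<in>UNIV. j $ e $ i * euler_lin c (axis (Inr e) 1) (Inl k)))))"
  by (simp add: prolong_def total_deriv_def pderiv_at_euler_comb[OF assms])

text \<open>Carries the evaluation of the table over the integers to any scalar field.\<close>

lemma of_int_euler_bracket:
  assumes "k \<in> {1..13}"
  shows "of_int (euler_bracket c d k) = euler_bracket (\<lambda>i. of_int (c i)) (\<lambda>i. of_int (d i)) k"
  using assms unfolding euler_indices
  by (elim insertE; simp add: euler_bracket_def)

text \<open>Integer coefficients and list ranges make the statement executable, so all pairs are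
  checked by evaluation.\<close>

lemma euler_bracket_table:
  "\<forall>i\<in>set [1..<14]. \<forall>j\<in>set [1..<14]. i < j \<longrightarrow> (\<forall>k\<in>set [1..<14].
     euler_bracket (\<lambda>k. of_bool (k = i)) (\<lambda>k. of_bool (k = j)) k =
     (case map_of euler_commutators (i, j) of
        None \<Rightarrow> 0 | Some (s, l) \<Rightarrow> s * of_bool (k = l)))"
  by code_simp

lemma generate_euler_algebra:
  assumes "open M" "M \<noteq> {}"
  shows "generate_euler_algebra M (euler_generator M :: nat \<Rightarrow> 'k::real_normed_field euler_vfield)"
    (is "generate_euler_algebra M ?X")
  unfolding generate_euler_algebra_def
proof (intro conjI ballI impI)
  show "lie_algebra vf_scale (lie_bracket M) (vf.span (?X ` {1..13}))"
    by (rule lie_algebra_euler[OF assms(1)])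
  show inj: "inj_on ?X {1..13}"
  proof (rule inj_onI)
    fix i j assume ij: "i \<in> {1..13::nat}" "j \<in> {1..13}" "?X i = ?X j"
    \<comment> \<open>The coefficients of the difference of generators \<open>i\<close> and
      \<open>j\<close>, in a form that matches \<open>euler_comb_add\<close> and
      \<open>euler_comb_scale\<close>; the entry at \<open>i\<close> is 1 unless
      \<open>i = j\<close>.\<close>
    let ?c = "\<lambda>k. of_bool (k = i) + - 1 * of_bool (k = j) :: 'k"
    have "euler_comb M ?c = ?X i + vf_scale (- 1) (?X j)"
      using ij(1,2) by (simp only: euler_comb_add[symmetric] euler_comb_scale[symmetric] euler_generator_eq_comb)
    also have "\<dots> = 0"
      by (simp add: ij(3) vf_scale_def fun_eq_iff vec_eq_iff)
    finally have "?c i = 0"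
      using euler_comb_eq_0_iff[OF assms, of ?c] ij(1) by blast
    then show "i = j" by (auto split: if_splits)
  qed
  show "vf.independent (?X ` {1..13})"
  proof (rule vf.independent_if_scalars_zero)
    fix f X assume 0: "(\<Sum>X\<in>?X ` {1..13}. vf_scale (f X) X) = 0" and X: "X \<in> ?X ` {1..13}"
    from 0 have "euler_comb M (\<lambda>i. f (?X i)) = 0"
      by (simp only: euler_comb_eq_sum sum.reindex[OF inj] o_def)
    then show "f X = 0"
      using X by (auto simp: euler_comb_eq_0_iff[OF assms])
  qed simp
  fix i j :: nat assume ij: "i \<in> {1..13}" "j \<in> {1..13}" "i < j"
  let ?e = "\<lambda>i k. of_bool (k = i) :: 'k"
  have "euler_bracket (?e i) (?e j) k =
      (case map_of euler_commutators (i, j) of None \<Rightarrow> 0 | Some (s, l) \<Rightarrow> of_int s * ?e l k)"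
    if k: "k \<in> {1..13}" for k
  proof -
    have "euler_bracket (?e i) (?e j) k =
        of_int (euler_bracket (\<lambda>k. of_bool (k = i)) (\<lambda>k. of_bool (k = j)) k)"
      by (simp add: of_int_euler_bracket[OF k])
    then show ?thesis
      using euler_bracket_table ij k
      by (simp add: atLeastLessThanSuc_atLeastAtMost[symmetric] del: One_nat_def split: option.splits prod.splits)
  qed
  moreover have "l \<in> {1..13}" if "map_of euler_commutators (i, j) = Some (s, l)" for s l
    using map_of_SomeD[OF that] by (auto simp: euler_commutators_def)
  ultimately show "lie_bracket M (?X i) (?X j) =
      (case map_of euler_commutators (i, j) of
         None \<Rightarrow> 0 | Some (s, k) \<Rightarrow> vf_scale (of_int s) (?X k))"
    using ij by (auto simp: euler_generator_eq_comb lie_bracket_euler_comb[OF assms(1)]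
        euler_comb_scale simp flip: euler_comb_zero[of M] split: option.splits
        intro!: euler_comb_cong)
qed

section \<open>Combinations of the generators are symmetries\<close>

text \<open>Once the time derivatives are eliminated, the linearized equations are identities in the
  base point, the spatial derivatives and the coefficients, for every \<gamma>.\<close>

lemma euler_comb_in_symmetries:
  fixes c :: "nat \<Rightarrow> real"
  assumes "open M"
  shows "euler_comb M c \<in> euler_symmetries \<gamma> M"
  unfolding euler_symmetries_def infinitesimal_symmetries_def
proof (intro CollectI conjI ballI allI impI)
  show "smooth_on M (euler_comb M c)" by (rule smooth_on_euler_comb[OF assms])
  show "euler_comb M c b = 0" if "b \<notin> M" for b
    using that by (simp add: euler_comb_def on_domain_def)
  fix J assume J: "J \<in> euler_manifold \<gamma> M"
  obtain b j where bj: "J = (b, j)" by (cases J)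
  have b: "b \<in> M" "b $ Inr cq \<noteq> 0" and res: "\<And>d. euler_residual \<gamma> b j d = 0"
    using J by (auto simp: bj euler_manifold_iff)
  define \<kappa> where "\<kappa> = snd (prolong (euler_comb M c) (b, j))"
  note simps = euler_residual_def euler_linearized_def material_def advect_def flow_div_def
  \<comment> \<open>Writing the pressure gradient as q times \<open>P\<close> clears the denominator
    q from the momentum equations.\<close>
  define P where "P i = j $ cp $ i / b $ Inr cq" for i
  have P: "j $ cp $ i = b $ Inr cq * P i" for i
    using b by (simp add: P_def)
  have time: "j $ cu $ ct = - advect b (j $ cu) - P cx"
    "j $ cv $ ct = - advect b (j $ cv) - P cy"
    "j $ cw $ ct = - advect b (j $ cw) - P cz"
    "b $ Inr cq * P ct = - advect b (j $ cp) - \<gamma> * b $ Inr cp * flow_div j"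
    "j $ cq $ ct = - advect b (j $ cq) - b $ Inr cq * flow_div j"
    using res[of cu] res[of cv] res[of cw] res[of cp] res[of cq] b
    by (simp_all add: simps P)
  have "euler_linearized \<gamma> b j (euler_comb M c b) \<kappa> d = 0" for d
    using b
    by (cases d; simp add: \<kappa>_def prolong_euler_comb[OF assms] UNIV_euler_indep UNIV_euler_dep
          axis_def euler_comb_nth euler_linearized_def simps time P del: times_divide_eq_right;
        simp add: algebra_simps add_divide_distrib diff_divide_distrib power2_eq_square)
  then show "tangent_vector (euler_manifold \<gamma> M) J (prolong (euler_comb M c) J)"
    using tangent_vector_euler_manifold[OF assms J[unfolded bj], of "euler_comb M c b" \<kappa>]
    by (simp add: bj \<kappa>_def prolong_euler_comb[OF assms b(1)])
qed

section \<open>The determining equations at a point\<close>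

text \<open>\<open>vel ct\<close> is left unspecified; hence the hypotheses of the form
  \<open>k \<noteq> ct\<close> below.\<close>

fun vel :: "euler_indep \<Rightarrow> euler_dep" where
  "vel cx = cu" | "vel cy = cv" | "vel cz = cw"

text \<open>The pressure gradient is \<open>q\<close> times \<open>G cp\<close>, which avoids denominators.\<close>

definition euler_jet_of ::
  "real \<Rightarrow> euler_point \<Rightarrow> (euler_dep \<Rightarrow> euler_indep \<Rightarrow> real) \<Rightarrow> real ^ euler_indep ^ euler_dep" where
  "euler_jet_of \<gamma> b G =
     (let g = \<lambda>d i. if d = cp then b $ Inr cq * G d i else G d i;
          \<theta> = G cu cx + G cv cy + G cw cz
      in \<chi> d i. if i = ct
        then - (b $ Inr cu * g d cx + b $ Inr cv * g d cy + b $ Inr cw * g d cz)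
          - (case d of cu \<Rightarrow> G cp cx | cv \<Rightarrow> G cp cy | cw \<Rightarrow> G cp cz
              | cp \<Rightarrow> \<gamma> * b $ Inr cp * \<theta> | cq \<Rightarrow> b $ Inr cq * \<theta>)
        else g d i)"

lemma euler_jet_of_nth:
  "euler_jet_of \<gamma> b G $ cu $ ct =
     - (b $ Inr cu * G cu cx + b $ Inr cv * G cu cy + b $ Inr cw * G cu cz) - G cp cx"
  "euler_jet_of \<gamma> b G $ cv $ ct =
     - (b $ Inr cu * G cv cx + b $ Inr cv * G cv cy + b $ Inr cw * G cv cz) - G cp cy"
  "euler_jet_of \<gamma> b G $ cw $ ct =
     - (b $ Inr cu * G cw cx + b $ Inr cv * G cw cy + b $ Inr cw * G cw cz) - G cp cz"
  "euler_jet_of \<gamma> b G $ cp $ ct =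
     - (b $ Inr cq * (b $ Inr cu * G cp cx + b $ Inr cv * G cp cy + b $ Inr cw * G cp cz))
     - \<gamma> * b $ Inr cp * (G cu cx + G cv cy + G cw cz)"
  "euler_jet_of \<gamma> b G $ cq $ ct =
     - (b $ Inr cu * G cq cx + b $ Inr cv * G cq cy + b $ Inr cw * G cq cz)
     - b $ Inr cq * (G cu cx + G cv cy + G cw cz)"
  "i \<noteq> ct \<Longrightarrow> euler_jet_of \<gamma> b G $ cp $ i = b $ Inr cq * G cp i"
  "i \<noteq> ct \<Longrightarrow> d \<noteq> cp \<Longrightarrow> euler_jet_of \<gamma> b G $ d $ i = G d i"
  by (simp_all add: euler_jet_of_def Let_def algebra_simps)

text \<open>Any spatial derivatives \<open>G\<close> extend to a solution of the equations at
  \<open>b\<close>, so they act as independent unknowns.\<close>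

lemma euler_residual_jet_of:
  "b $ Inr cq \<noteq> 0 \<Longrightarrow> euler_residual \<gamma> b (euler_jet_of \<gamma> b G) d = 0"
  by (cases d) (simp_all add: euler_residual_def euler_jet_of_nth material_def flow_div_def algebra_simps)

text \<open>The derivative part of \<open>prolong\<close> with numbers in place of partial
  derivatives: \<open>D a c\<close> stands for the derivative of component \<open>c\<close> in
  coordinate \<open>a\<close>.\<close>

definition prolong_coeff ::
  "(euler_indep + euler_dep \<Rightarrow> euler_indep + euler_dep \<Rightarrow> real) \<Rightarrow>
   real ^ euler_indep ^ euler_dep \<Rightarrow> real ^ euler_indep ^ euler_dep" where
  "prolong_coeff D j = (\<chi> d i. D (Inl i) (Inr d) + (\<Sum>e\<in>UNIV. j $ e $ i * D (Inr e) (Inr d))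
     - (\<Sum>k\<in>UNIV. j $ d $ k * (D (Inl i) (Inl k) + (\<Sum>e\<in>UNIV. j $ e $ i * D (Inr e) (Inl k)))))"

text \<open>At a single base point the symmetry condition is pure algebra: \<beta> holds the values
  of the field and \<open>D\<close> its first derivatives, as unknown numbers.\<close>

locale symmetry_at_point =
  fixes \<gamma> :: real and b \<beta> :: euler_point
    and D :: "euler_indep + euler_dep \<Rightarrow> euler_indep + euler_dep \<Rightarrow> real"
  assumes q: "b $ Inr cq \<noteq> 0"
    and lin: "\<And>j d. (\<And>d. euler_residual \<gamma> b j d = 0) \<Longrightarrow>
      euler_linearized \<gamma> b j \<beta> (prolong_coeff D j) d = 0"
begin

definition L :: "(euler_dep \<Rightarrow> euler_indep \<Rightarrow> real) \<Rightarrow> euler_dep \<Rightarrow> real" where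
  "L G d = euler_linearized \<gamma> b (euler_jet_of \<gamma> b G) \<beta> (prolong_coeff D (euler_jet_of \<gamma> b G)) d"

lemma L_zero: "L G d = 0"
  unfolding L_def by (rule lin) (rule euler_residual_jet_of[OF q])

text \<open>
  \<open>L G d\<close> is a polynomial of degree two in \<open>G\<close>: \<open>L G + L (-G) - 2 L 0\<close> is twice its quadratic
  part, and \<open>L G - L 0\<close> is its linear part at those \<open>G\<close> where the quadratic part vanishes.
\<close>

lemma quadratic_part: "2 * c = L G d + L (\<lambda>d i. - G d i) d - 2 * L (\<lambda>_ _. 0) d \<Longrightarrow> c = 0"
  by (simp add: L_zero)

lemma linear_part: "c = L G d - L (\<lambda>_ _. 0) d \<Longrightarrow> c = 0"
  by (simp add: L_zero)

definition unit :: "euler_dep \<Rightarrow> euler_indep \<Rightarrow> euler_dep \<Rightarrow> euler_indep \<Rightarrow> real" where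
  "unit d i = (\<lambda>d' i'. of_bool (d' = d \<and> i' = i))"

lemmas L_simps = L_def unit_def euler_linearized_def euler_jet_of_nth prolong_coeff_def
  material_def advect_def flow_div_def UNIV_euler_indep UNIV_euler_dep

section \<open>Quadratic terms: \<xi> is independent of u, v, w, p, q\<close>

text \<open>A pressure gradient along x produces an acceleration u_t, and the product u_t p_x enters
  the divergence in the density equation.\<close>

lemma xi0_p: "D (Inr cp) (Inl ct) = 0"
proof -
  have "(b $ Inr cq)\<^sup>2 * D (Inr cp) (Inl ct) = 0"
    by (rule quadratic_part[where G = "unit cp cx" and d = cq])
      (simp add: L_simps; simp add: algebra_simps power2_eq_square)
  then show ?thesis using q by simp
qed

text \<open>The pressure gradient along \<open>m\<close> accelerates the flow along
  \<open>m\<close>; its product with the density gradient along \<open>k\<close> isolates this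
  combination.\<close>

lemma xi_u_offdiag:
  assumes "k \<noteq> ct" "m \<noteq> ct" "k \<noteq> m"
  shows "D (Inr (vel m)) (Inl k) - b $ Inr (vel k) * D (Inr (vel m)) (Inl ct) = 0"
  using assms
  by (intro quadratic_part[where G = "\<lambda>d i. unit cq k d i + unit cp m d i" and d = cq], cases k; cases m)
    (simp_all add: L_simps xi0_p, simp_all add: algebra_simps)

text \<open>Opposite strains along \<open>k\<close> and \<open>m\<close> cancel in the divergence,
  so density and pressure are stationary, while their squares add up in the quadratic part.\<close>

lemma xi_u_diag_sum:
  assumes "k \<noteq> ct" "m \<noteq> ct" "k \<noteq> m"
  shows "D (Inr (vel k)) (Inl k) - b $ Inr (vel k) * D (Inr (vel k)) (Inl ct)
    + (D (Inr (vel m)) (Inl m) - b $ Inr (vel m) * D (Inr (vel m)) (Inl ct)) = 0" (is "?c = 0")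
proof -
  have "- b $ Inr cq * ?c = 0"
    using assms
    by (intro quadratic_part[where G = "\<lambda>d i. unit (vel k) k d i - unit (vel m) m d i" and d = cq],
        cases k; cases m) (simp_all add: L_simps xi0_p, simp_all add: algebra_simps)
  then show ?thesis using q by simp
qed

text \<open>Three numbers with vanishing pairwise sums are zero.\<close>

lemma xi_u_diag:
  assumes "k \<noteq> ct"
  shows "D (Inr (vel k)) (Inl k) - b $ Inr (vel k) * D (Inr (vel k)) (Inl ct) = 0"
  using assms xi_u_diag_sum[of cx cy] xi_u_diag_sum[of cx cz] xi_u_diag_sum[of cy cz]
  by (cases k) simp_all

text \<open>A pure strain u_x makes q_t nonzero, and the square of q_t supplies this
  coefficient.\<close>

lemma xi0_q: "D (Inr cq) (Inl ct) = 0"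
proof -
  have "- (b $ Inr cq)\<^sup>2 * D (Inr cq) (Inl ct)
      - b $ Inr cq * (D (Inr cu) (Inl cx) - b $ Inr cu * D (Inr cu) (Inl ct)) = 0"
    by (rule quadratic_part[where G = "unit cu cx" and d = cq])
      (simp add: L_simps xi0_p; simp add: algebra_simps power2_eq_square)
  then show ?thesis using xi_u_diag[of cx] q by simp
qed

text \<open>The derivative of the k-th velocity in direction \<open>j\<close> is a divergence-free
  shear; it is paired with a density gradient along \<open>k\<close>.\<close>

lemma xi_q: "D (Inr cq) (Inl j) = 0"
proof (cases "j = ct")
  case False
  then obtain k where k: "k \<noteq> ct" "j \<noteq> k"
    by (metis euler_indep.distinct(1,3,7))
  with False have "- b $ Inr cq * D (Inr cq) (Inl j) = 0"
    by (intro quadratic_part[where G = "\<lambda>d i. unit cq k d i + unit (vel k) j d i" and d = cq], cases j; cases k)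
      (simp_all add: L_simps xi0_p xi0_q, simp_all add: algebra_simps)
  then show ?thesis using q by simp
qed (simp add: xi0_q)

text \<open>The shear of \<open>xi_q\<close>, now paired with a pressure gradient.\<close>

lemma xi_p: "D (Inr cp) (Inl j) = 0"
proof (cases "j = ct")
  case False
  then obtain k where k: "k \<noteq> ct" "j \<noteq> k"
    by (metis euler_indep.distinct(1,3,7))
  with False have "- (b $ Inr cq)\<^sup>2 * D (Inr cp) (Inl j) = 0"
    by (intro quadratic_part[where G = "\<lambda>d i. unit cp k d i + unit (vel k) j d i" and d = cq], cases j; cases k)
      (simp_all add: L_simps xi0_p, simp_all add: algebra_simps power2_eq_square)
  then show ?thesis using q by simp
qed (simp add: xi0_p)

text \<open>The acceleration caused by a pressure gradient along \<open>m\<close> is paired with the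
  shear of the j-th velocity along \<open>m\<close>.\<close>

lemma xi0_u:
  assumes "j \<noteq> ct"
  shows "D (Inr (vel j)) (Inl ct) = 0"
proof -
  obtain m where "m \<noteq> ct" "j \<noteq> m"
    by (metis euler_indep.distinct(1,3,7))
  with assms have "b $ Inr cq * D (Inr (vel j)) (Inl ct) = 0"
    by (intro quadratic_part[where G = "\<lambda>d i. unit cp m d i + unit (vel j) m d i" and d = cq], cases j; cases m)
      (simp_all add: L_simps xi_p, simp_all add: algebra_simps)
  then show ?thesis using q by simp
qed

text \<open>The quadratic terms of \<open>L\<close> all carry these factors, so from here on
  \<open>L\<close> is affine in \<open>G\<close> and \<open>linear_part\<close> applies at every
  \<open>G\<close>.\<close>

lemma xi_dep: "D (Inr e) (Inl k) = 0"
proof -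
  have "D (Inr (vel j)) (Inl k) = 0" if "j \<noteq> ct" for j
    using that xi_u_diag[of j] xi_u_offdiag[of k j] xi0_u[of j] by (cases "k = ct"; cases "k = j") auto
  from this[of cx] this[of cy] this[of cz] show ?thesis
    by (cases e) (simp_all add: xi_p xi_q)
qed

section \<open>Linear terms: the velocity, pressure and density coefficients\<close>

lemma eta_q:
  assumes "\<gamma> \<noteq> 0" "b $ Inr cp \<noteq> 0" "k \<noteq> ct"
  shows "D (Inr cq) (Inr (vel k)) = 0"
proof -
  have "\<gamma> * b $ Inr cp * D (Inr cq) (Inr (vel k)) = 0"
    using assms(3) by (intro linear_part[where G = "unit cq k" and d = cp], cases k)
      (simp_all add: L_simps xi_dep, simp_all add: algebra_simps)
  then show ?thesis using assms by simp
qed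

text \<open>The material derivative of component \<open>a\<close> at the jet whose spatial
  derivatives all vanish.\<close>

definition D\<^sub>u :: "euler_indep + euler_dep \<Rightarrow> real" where
  "D\<^sub>u a = D (Inl ct) a + b $ Inr cu * D (Inl cx) a + b $ Inr cv * D (Inl cy) a
     + b $ Inr cw * D (Inl cz) a"

lemma eta_eq':
  assumes "\<gamma> \<noteq> 0" "b $ Inr cp \<noteq> 0" "k \<noteq> ct"
  shows "\<beta> $ Inr (vel k) = D\<^sub>u (Inl k) - b $ Inr (vel k) * D\<^sub>u (Inl ct)"
proof -
  have "- (D\<^sub>u (Inl k) - b $ Inr (vel k) * D\<^sub>u (Inl ct) - \<beta> $ Inr (vel k))
      + b $ Inr cq * D (Inr cq) (Inr (vel k)) = 0"
    using assms(3) by (intro linear_part[where G = "unit cq k" and d = cq], cases k)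
      (simp_all add: L_simps xi_dep D\<^sub>u_def, simp_all add: algebra_simps)
  then show ?thesis using eta_q[OF assms] by simp
qed

lemma pi_u:
  assumes "m \<noteq> ct"
  shows "D (Inr (vel m)) (Inr cp) = 0"
proof -
  obtain i where "i \<noteq> ct" "m \<noteq> i"
    by (metis euler_indep.distinct(1,3,7))
  with assms have "D (Inr (vel m)) (Inr cp) / b $ Inr cq = 0"
    by (intro linear_part[where G = "unit (vel m) i" and d = "vel i"], cases i; cases m)
      (simp_all add: L_simps xi_dep, simp_all add: algebra_simps add_divide_distrib diff_divide_distrib)
  then show ?thesis using q by simp
qed

text \<open>A strain along another axis shows that the first unknown is q times the second; a
  pressure gradient along \<open>i\<close> shows the same with the opposite sign.\<close>

lemma xi0_space_eta_p:
  assumes "\<gamma> \<noteq> 0" "b $ Inr cp \<noteq> 0" "i \<noteq> ct"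
  shows "D (Inl i) (Inl ct) = 0" and "D (Inr cp) (Inr (vel i)) = 0"
proof -
  let ?p = "b $ Inr cp" and ?q = "b $ Inr cq"
  obtain j where j: "j \<noteq> ct" "j \<noteq> i"
    by (metis euler_indep.distinct(1,3,7))
  with assms(3) have "- \<gamma> * ?p * D (Inr cp) (Inr (vel i)) - ?q * D (Inr cq) (Inr (vel i))
      + \<gamma> * ?p * D (Inl i) (Inl ct) / ?q = 0"
    by (intro linear_part[where G = "unit (vel j) j" and d = "vel i"], cases i; cases j)
      (simp_all add: L_simps xi_dep pi_u, simp_all add: algebra_simps add_divide_distrib diff_divide_distrib)
  then have "\<gamma> * ?p * D (Inl i) (Inl ct) = \<gamma> * ?p * (?q * D (Inr cp) (Inr (vel i)))"
    using q by (simp add: eta_q[OF assms] field_simps)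
  then have 1: "D (Inl i) (Inl ct) = ?q * D (Inr cp) (Inr (vel i))"
    using assms by simp
  have "- D (Inr (vel i)) (Inr cp)
      - ?q * (D\<^sub>u (Inl i) - b $ Inr (vel i) * D\<^sub>u (Inl ct) - \<beta> $ Inr (vel i))
      + \<gamma> * ?p * (?q * D (Inr cp) (Inr (vel i)) + D (Inl i) (Inl ct)) = 0"
    using assms(3) by (intro linear_part[where G = "unit cp i" and d = cp], cases i)
      (simp_all add: L_simps xi_dep D\<^sub>u_def, simp_all add: algebra_simps)
  then have "?q * D (Inr cp) (Inr (vel i)) + D (Inl i) (Inl ct) = 0"
    using assms by (simp add: pi_u eta_eq')
  with 1 q show "D (Inl i) (Inl ct) = 0" "D (Inr cp) (Inr (vel i)) = 0"
    by simp_all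
qed

lemma eta_eq:
  assumes "\<gamma> \<noteq> 0" "b $ Inr cp \<noteq> 0" "k \<noteq> ct"
  shows "\<beta> $ Inr (vel k) = D\<^sub>u (Inl k) - b $ Inr (vel k) * D (Inl ct) (Inl ct)"
  using eta_eq'[OF assms] xi0_space_eta_p(1)[OF assms(1,2)] by (simp add: D\<^sub>u_def)

lemma pi_q: "D (Inr cq) (Inr cp) = 0"
proof -
  have "D (Inr cq) (Inr cp) / b $ Inr cq = 0"
    by (rule linear_part[where G = "unit cq cx" and d = cu])
      (simp add: L_simps xi_dep; simp add: algebra_simps add_divide_distrib)
  then show ?thesis using q by simp
qed

lemma pi_p:
  assumes "\<gamma> \<noteq> 0" "b $ Inr cp \<noteq> 0" "k \<noteq> ct"
  shows "b $ Inr cp * D (Inr cp) (Inr cp) = \<beta> $ Inr cp + b $ Inr cp *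
    (D (Inl ct) (Inl ct) + D (Inr (vel k)) (Inr (vel k)) - D (Inl k) (Inl k))"
proof -
  let ?p = "b $ Inr cp"
  have "- (\<gamma> * ?p * D (Inr cp) (Inr cp) + b $ Inr cq * D (Inr cq) (Inr cp)) + \<gamma> * ?p * D (Inl ct) (Inl ct)
    + \<gamma> * \<beta> $ Inr cp + \<gamma> * ?p * (D (Inr (vel k)) (Inr (vel k)) - D (Inl k) (Inl k)) = 0"
    using assms(3)
    by (intro linear_part[where G = "unit (vel k) k" and d = cp], cases k)
      (simp_all add: L_simps xi_dep xi0_space_eta_p[OF assms(1,2)], simp_all add: algebra_simps)
  then have "\<gamma> * (- ?p * D (Inr cp) (Inr cp) + ?p * D (Inl ct) (Inl ct)
    + \<beta> $ Inr cp + ?p * (D (Inr (vel k)) (Inr (vel k)) - D (Inl k) (Inl k))) = 0"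
    by (simp add: pi_q algebra_simps)
  then have "- ?p * D (Inr cp) (Inr cp) + ?p * D (Inl ct) (Inl ct)
    + \<beta> $ Inr cp + ?p * (D (Inr (vel k)) (Inr (vel k)) - D (Inl k) (Inl k)) = 0"
    using assms(1) by (simp only: mult_eq_0_iff) simp
  then show ?thesis by (simp add: algebra_simps)
qed

text \<open>The coefficient of the pressure gradient along \<open>m\<close> in the i-th momentum
  equation. With the later \<open>eta_vel\<close> it becomes the conformal Killing equation.\<close>

lemma conformal:
  assumes "\<gamma> \<noteq> 0" "b $ Inr cp \<noteq> 0" "i \<noteq> ct" "m \<noteq> ct"
  shows "D (Inr (vel m)) (Inr (vel i)) + D (Inl i) (Inl m) =
    of_bool (i = m) * (D (Inl ct) (Inl ct) + D (Inr cp) (Inr cp) - \<beta> $ Inr cq / b $ Inr cq)"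
proof -
  have "- D (Inr (vel m)) (Inr (vel i)) - D (Inl i) (Inl m) +
    of_bool (i = m) * (D (Inl ct) (Inl ct) + D (Inr cp) (Inr cp) - \<beta> $ Inr cq / b $ Inr cq) = 0"
    using assms(3,4) q
    by (intro linear_part[where G = "unit cp m" and d = "vel i"], cases i; cases m)
      (simp_all add: L_simps xi_dep pi_u xi0_space_eta_p[OF assms(1,2)],
       simp_all add: algebra_simps add_divide_distrib diff_divide_distrib power2_eq_square)
  then show ?thesis by simp
qed

text \<open>The terms of degree zero, from the jet with \<open>G = 0\<close>.\<close>

lemma inhomogeneous:
  shows "D\<^sub>u (Inr cq) + b $ Inr cq *
      (D (Inl cx) (Inr cu) + D (Inl cy) (Inr cv) + D (Inl cz) (Inr cw)) = 0"
    and "D\<^sub>u (Inr cp) + \<gamma> * b $ Inr cp *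
      (D (Inl cx) (Inr cu) + D (Inl cy) (Inr cv) + D (Inl cz) (Inr cw)) = 0"
    and "i \<noteq> ct \<Longrightarrow> b $ Inr cq * D\<^sub>u (Inr (vel i)) + D (Inl i) (Inr cp) = 0"
proof -
  show "D\<^sub>u (Inr cq) + b $ Inr cq *
      (D (Inl cx) (Inr cu) + D (Inl cy) (Inr cv) + D (Inl cz) (Inr cw)) = 0"
    using L_zero[of "\<lambda>_ _. 0" cq] by (simp add: L_simps D\<^sub>u_def; simp add: algebra_simps)
  show "D\<^sub>u (Inr cp) + \<gamma> * b $ Inr cp *
      (D (Inl cx) (Inr cu) + D (Inl cy) (Inr cv) + D (Inl cz) (Inr cw)) = 0"
    using L_zero[of "\<lambda>_ _. 0" cp] by (simp add: L_simps D\<^sub>u_def; simp add: algebra_simps)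
  show "b $ Inr cq * D\<^sub>u (Inr (vel i)) + D (Inl i) (Inr cp) = 0" if "i \<noteq> ct"
    using L_zero[of "\<lambda>_ _. 0" "vel i"] that q
    by (cases i) (simp_all add: L_simps D\<^sub>u_def, simp_all add: field_simps)
qed

end

section \<open>Integration of the determining equations\<close>

definition along_flow :: "(euler_indep \<Rightarrow> real) \<Rightarrow> euler_point \<Rightarrow> real" where
  "along_flow g b = b $ Inr cu * g cx + b $ Inr cv * g cy + b $ Inr cw * g cz"

lemma along_flow_zero [simp]: "along_flow (\<lambda>i. 0) b = 0"
  by (simp add: along_flow_def)

lemma along_flow_cong: "(\<And>i. i \<noteq> ct \<Longrightarrow> g i = h i) \<Longrightarrow> along_flow g b = along_flow h b"
  by (simp add: along_flow_def)

text \<open>If the \<open>g i\<close> are independent of the velocities, the derivative in the m-th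
  velocity extracts \<open>g m\<close>; this is how velocity-affine identities are split
  below.\<close>

lemma pderiv_along_flow:
  assumes "\<And>i. i \<noteq> ct \<Longrightarrow> g i differentiable at b"
  shows "(\<lambda>x. along_flow (\<lambda>i. g i x) x) differentiable at b"
    and "a \<notin> {Inr cu, Inr cv, Inr cw} \<Longrightarrow>
      pderiv_at a (\<lambda>x. along_flow (\<lambda>i. g i x) x) b = along_flow (\<lambda>i. pderiv_at a (g i) b) b"
    and "m \<noteq> ct \<Longrightarrow> pderiv_at (Inr (vel m)) (\<lambda>x. along_flow (\<lambda>i. g i x) x) b =
      along_flow (\<lambda>i. pderiv_at (Inr (vel m)) (g i) b) b + g m b"
  subgoal using assms by (simp add: along_flow_def)
  subgoal using assms by (auto simp: along_flow_def pderiv_at_arith)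
  subgoal using assms by (cases m) (simp_all add: along_flow_def pderiv_at_arith)
  done

lemma vel_eq_iff: "k \<noteq> ct \<Longrightarrow> m \<noteq> ct \<Longrightarrow> vel k = vel m \<longleftrightarrow> k = m"
  by (cases k; cases m) simp_all

lemma vel_neq [simp]: "k \<noteq> ct \<Longrightarrow> vel k \<noteq> cp" "k \<noteq> ct \<Longrightarrow> vel k \<noteq> cq"
  "k \<noteq> ct \<Longrightarrow> cp \<noteq> vel k" "k \<noteq> ct \<Longrightarrow> cq \<noteq> vel k"
  by (cases k; simp)+

lemma vel_cases: obtains (vel) k where "k \<noteq> ct" "e = vel k" | (p) "e = cp" | (q) "e = cq"
  by (cases e) (metis euler_indep.distinct(1,3,5) vel.simps)+

section \<open>The determining equations as differential equations\<close>

locale euler_symmetry =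
  fixes \<gamma> :: real and M :: "euler_point set" and X :: "real euler_vfield"
  assumes M: "open M" and X: "X \<in> euler_symmetries \<gamma> M" and \<gamma>: "\<gamma> \<noteq> 0"
begin

text \<open>The relations at a point were obtained by cancelling factors p and q.\<close>

definition U :: "euler_point set" where
  "U = {b \<in> M. b $ Inr cp \<noteq> 0 \<and> b $ Inr cq \<noteq> 0}"

text \<open>The index order is reversed against \<open>symmetry_at_point\<close>: there
  \<open>D a c\<close> is \<open>DX c a b\<close>.\<close>

definition DX :: "euler_indep + euler_dep \<Rightarrow> euler_indep + euler_dep \<Rightarrow> euler_point \<Rightarrow> real" where
  "DX c a = pderiv_at a (\<lambda>b. X b $ c)"

lemma open_U: "open U"
proof -
  have "U = M \<inter> ({b. b $ Inr cp \<noteq> 0} \<inter> {b. b $ Inr cq \<noteq> 0})"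
    by (auto simp: U_def)
  moreover have "open ({b::euler_point. b $ Inr cp \<noteq> 0} \<inter> {b. b $ Inr cq \<noteq> 0})"
    by (intro open_Int open_Collect_neq continuous_intros)
  ultimately show ?thesis using M by auto
qed

lemma smooth_X: "smooth_on M (\<lambda>b. X b $ c)"
  using X M by (auto simp: euler_symmetries_def infinitesimal_symmetries_def intro: smooth_on_component)

lemma smooth_X_U: "smooth_on U (\<lambda>b. X b $ c)"
  by (rule smooth_on_subset[OF smooth_X]) (auto simp: U_def)

lemma smooth_DX: "smooth_on U (DX c a)"
  unfolding DX_def by (rule smooth_on_pderiv[OF smooth_X_U])

lemma diff_X [simp]: "b \<in> U \<Longrightarrow> (\<lambda>b. X b $ c) differentiable at b"
  by (rule smooth_on_differentiable[OF smooth_X_U])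

lemma diff_DX [simp]: "b \<in> U \<Longrightarrow> DX c a differentiable at b"
  by (rule smooth_on_differentiable[OF smooth_DX])

lemma diff_DDX [simp]: "b \<in> U \<Longrightarrow> pderiv_at a' (DX c a) differentiable at b"
  by (rule smooth_on_differentiable[OF smooth_on_pderiv[OF smooth_DX]])

lemma DX_commute: "b \<in> U \<Longrightarrow> pderiv_at a' (DX c a) b = pderiv_at a (DX c a') b"
  unfolding DX_def by (rule pderiv_at_commute[OF open_U smooth_X_U])

lemma DDX_commute:
  "b \<in> U \<Longrightarrow> pderiv_at e (pderiv_at a' (DX c a)) b = pderiv_at a' (pderiv_at e (DX c a)) b"
  by (rule pderiv_at_commute[OF open_U smooth_DX])

lemma pderiv_cong: "b \<in> U \<Longrightarrow> (\<And>x. x \<in> U \<Longrightarrow> f x = g x) \<Longrightarrow> pderiv_at a f b = pderiv_at a g b"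
  by (rule pderiv_at_cong_open[OF open_U])

lemma pderiv_zero: "b \<in> U \<Longrightarrow> (\<And>x. x \<in> U \<Longrightarrow> f x = 0) \<Longrightarrow> pderiv_at a f b = 0"
  using pderiv_cong[of b f "\<lambda>_. 0"] by simp

lemma at_point:
  assumes "b \<in> M" "b $ Inr cq \<noteq> 0"
  shows "symmetry_at_point \<gamma> b (X b) (\<lambda>a c. DX c a b)"
proof
  fix j d assume "\<And>d. euler_residual \<gamma> b j d = 0"
  then have J: "(b, j) \<in> euler_manifold \<gamma> M"
    using assms by (simp add: euler_manifold_iff)
  have "prolong X (b, j) = (X b, prolong_coeff (\<lambda>a c. DX c a b) j)"
    by (simp add: prolong_def total_deriv_def prolong_coeff_def DX_def)
  then show "euler_linearized \<gamma> b j (X b) (prolong_coeff (\<lambda>a c. DX c a b) j) d = 0"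
    using X J tangent_vector_euler_manifold[OF M J]
    by (auto simp: euler_symmetries_def infinitesimal_symmetries_def)
qed (rule assms(2))

lemma U_point:
  assumes "b \<in> U"
  shows "symmetry_at_point \<gamma> b (X b) (\<lambda>a c. DX c a b)" "b $ Inr cp \<noteq> 0" "b $ Inr cq \<noteq> 0"
  using assms at_point by (auto simp: U_def)

lemma X_dep: "b \<in> U \<Longrightarrow> DX (Inl k) (Inr e) b = 0"
  by (rule symmetry_at_point.xi_dep[OF U_point(1)])

lemma X_time: "b \<in> U \<Longrightarrow> i \<noteq> ct \<Longrightarrow> DX (Inl ct) (Inl i) b = 0"
  using symmetry_at_point.xi0_space_eta_p(1)[OF U_point(1) \<gamma> U_point(2)] by blast

text \<open>A first derivative that vanishes on the open set \<open>U\<close> kills every second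
  derivative that involves it, in either order.\<close>

lemma DX_zero2:
  assumes "b \<in> U" "\<And>x. x \<in> U \<Longrightarrow> DX c a x = 0"
  shows "pderiv_at a' (DX c a) b = 0" and "pderiv_at a (DX c a') b = 0"
proof -
  show "pderiv_at a' (DX c a) b = 0" using assms by (rule pderiv_zero)
  then show "pderiv_at a (DX c a') b = 0" by (subst DX_commute[OF assms(1)])
qed

lemma DDX_zero:
  assumes "b \<in> U" "\<And>x. x \<in> U \<Longrightarrow> pderiv_at e (DX c a) x = 0"
  shows "pderiv_at e (pderiv_at a' (DX c a)) b = 0"
  by (subst DDX_commute[OF assms(1)]) (rule pderiv_zero[OF assms])

lemma X_dep2: "b \<in> U \<Longrightarrow> pderiv_at (Inr e) (DX (Inl k) a) b = 0"
  by (rule DX_zero2(2)[OF _ X_dep])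

lemma X_time2: "b \<in> U \<Longrightarrow> a \<noteq> Inl ct \<Longrightarrow> pderiv_at a (DX (Inl ct) (Inl ct)) b = 0"
  by (cases a) (auto intro: DX_zero2(2)[OF _ X_time] X_dep2)

lemma eta_eq:
  assumes "b \<in> U" "k \<noteq> ct"
  shows "X b $ Inr (vel k) = DX (Inl k) (Inl ct) b + along_flow (\<lambda>i. DX (Inl k) (Inl i) b) b
    - b $ Inr (vel k) * DX (Inl ct) (Inl ct) b"
  using symmetry_at_point.eta_eq[OF U_point(1)[OF assms(1)] \<gamma> U_point(2)[OF assms(1)] assms(2)]
  by (simp add: symmetry_at_point.D\<^sub>u_def[OF U_point(1)[OF assms(1)]] along_flow_def)

lemma eta_vel:
  assumes "b \<in> U" "k \<noteq> ct" "m \<noteq> ct"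
  shows "DX (Inr (vel k)) (Inr (vel m)) b =
    DX (Inl k) (Inl m) b - of_bool (k = m) * DX (Inl ct) (Inl ct) b"
proof -
  have "DX (Inr (vel k)) (Inr (vel m)) b = pderiv_at (Inr (vel m)) (\<lambda>b. DX (Inl k) (Inl ct) b
      + along_flow (\<lambda>i. DX (Inl k) (Inl i) b) b - b $ Inr (vel k) * DX (Inl ct) (Inl ct) b) b"
    using pderiv_cong[OF assms(1) eta_eq[OF _ assms(2)]] by (simp add: DX_def)
  also have "\<dots> = DX (Inl k) (Inl m) b - of_bool (k = m) * DX (Inl ct) (Inl ct) b"
    using assms by (simp add: pderiv_at_arith pderiv_along_flow X_dep2 vel_eq_iff)
  finally show ?thesis .
qed

lemma eta_p: "b \<in> U \<Longrightarrow> k \<noteq> ct \<Longrightarrow> DX (Inr (vel k)) (Inr cp) b = 0"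
  using symmetry_at_point.xi0_space_eta_p(2)[OF U_point(1) \<gamma> U_point(2)] by blast

lemma eta_q: "b \<in> U \<Longrightarrow> k \<noteq> ct \<Longrightarrow> DX (Inr (vel k)) (Inr cq) b = 0"
  using symmetry_at_point.eta_q[OF U_point(1) \<gamma> U_point(2)] by blast

text \<open>In \<open>pi_p\<close> the other terms multiplied by p cancel by \<open>eta_vel\<close>
  on the diagonal.\<close>

lemma pi_eq: "b \<in> U \<Longrightarrow> X b $ Inr cp = b $ Inr cp * DX (Inr cp) (Inr cp) b"
  using symmetry_at_point.pi_p[OF U_point(1) \<gamma> U_point(2), of b cx] eta_vel[of b cx cx] by simp

lemma pi_dep: "b \<in> U \<Longrightarrow> e \<noteq> cp \<Longrightarrow> DX (Inr cp) (Inr e) b = 0"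
  using symmetry_at_point.pi_u[OF U_point(1)] symmetry_at_point.pi_q[OF U_point(1)]
  by (cases e rule: vel_cases) auto

text \<open>Differentiating \<open>pi_eq\<close> in p leaves p times the p-derivative of this
  function; the other derivatives vanish by commuting with \<open>pi_dep\<close>.\<close>

lemma pi_p2: "b \<in> U \<Longrightarrow> pderiv_at (Inr e) (DX (Inr cp) (Inr cp)) b = 0"
proof (cases "e = cp")
  case True
  assume b: "b \<in> U"
  have "DX (Inr cp) (Inr cp) b =
      pderiv_at (Inr cp) (\<lambda>b. b $ Inr cp * DX (Inr cp) (Inr cp) b) b"
    using pderiv_cong[OF b pi_eq] by (simp add: DX_def)
  with b U_point(2)[OF b] show ?thesis by (simp add: pderiv_at_arith True)
next
  case False
  assume "b \<in> U"
  with False show ?thesis by (intro DX_zero2(2)[OF _ pi_dep])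
qed

lemma pi_pderiv:
  assumes "b \<in> U"
  shows "DX (Inr cp) (Inl i) b = b $ Inr cp * pderiv_at (Inl i) (DX (Inr cp) (Inr cp)) b"
proof -
  have "DX (Inr cp) (Inl i) b =
      pderiv_at (Inl i) (\<lambda>b. b $ Inr cp * DX (Inr cp) (Inr cp) b) b"
    using pderiv_cong[OF assms pi_eq] by (simp add: DX_def)
  with assms show ?thesis by (simp add: pderiv_at_arith)
qed

abbreviation \<tau> where "\<tau> \<equiv> DX (Inl ct) (Inl ct)"
abbreviation \<Lambda> where "\<Lambda> k m \<equiv> DX (Inl k) (Inl m)"
abbreviation P where "P \<equiv> DX (Inr cp) (Inr cp)"
abbreviation (input) \<eta> where "\<eta> k \<equiv> DX (Inr (vel k))"

lemma conformal:
  assumes "b \<in> U" "i \<noteq> ct" "m \<noteq> ct"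
  shows "\<Lambda> i m b + \<Lambda> m i b = of_bool (i = m) * (2 * \<tau> b + P b - X b $ Inr cq / b $ Inr cq)"
  using symmetry_at_point.conformal[OF U_point(1)[OF assms(1)] \<gamma> U_point(2)[OF assms(1)] assms(2,3)]
    eta_vel[OF assms] by (auto split: if_splits)

lemma rho_eq: "b \<in> U \<Longrightarrow> X b $ Inr cq = b $ Inr cq * (2 * \<tau> b + P b - 2 * \<Lambda> cx cx b)"
  using conformal[of b cx cx] U_point(3)[of b] by (simp add: field_simps)

lemma diagonal: "b \<in> U \<Longrightarrow> k \<noteq> ct \<Longrightarrow> \<Lambda> k k b = \<Lambda> cx cx b"
  using conformal[of b k k] conformal[of b cx cx] by simp

lemma inhomogeneous:
  assumes "b \<in> U"
  shows "DX (Inr cq) (Inl ct) b + along_flow (\<lambda>i. DX (Inr cq) (Inl i) b) b + b $ Inr cq *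
      (\<eta> cx (Inl cx) b + \<eta> cy (Inl cy) b + \<eta> cz (Inl cz) b) = 0"
    and "DX (Inr cp) (Inl ct) b + along_flow (\<lambda>i. DX (Inr cp) (Inl i) b) b + \<gamma> * b $ Inr cp *
      (\<eta> cx (Inl cx) b + \<eta> cy (Inl cy) b + \<eta> cz (Inl cz) b) = 0"
    and "k \<noteq> ct \<Longrightarrow> b $ Inr cq * (\<eta> k (Inl ct) b + along_flow (\<lambda>i. \<eta> k (Inl i) b) b)
      + DX (Inr cp) (Inl k) b = 0"
  using symmetry_at_point.inhomogeneous[OF U_point(1)[OF assms]]
  by (simp_all add: symmetry_at_point.D\<^sub>u_def[OF U_point(1)[OF assms]] along_flow_def add.assoc)

section \<open>The pressure factor and the dilation factor depend on t alone\<close>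

text \<open>In the momentum identity only the term with the factor p depends on p, so its derivative
  in p isolates this coefficient.\<close>

lemma P_space:
  assumes "b \<in> U" "k \<noteq> ct"
  shows "pderiv_at (Inl k) P b = 0"
proof -
  have "pderiv_at (Inr cp) (\<lambda>b. b $ Inr cq * (\<eta> k (Inl ct) b + along_flow (\<lambda>i. \<eta> k (Inl i) b) b)
      + b $ Inr cp * pderiv_at (Inl k) P b) b = 0"
    using inhomogeneous(3) pi_pderiv assms(2) by (intro pderiv_zero[OF assms(1)]) auto
  then show ?thesis
    using assms by (simp add: pderiv_at_arith pderiv_along_flow DDX_zero pi_p2
      DX_zero2(2)[OF _ eta_p])
qed

lemma eta_flow:
  assumes "b \<in> U" "k \<noteq> ct"
  shows "\<eta> k (Inl ct) b + along_flow (\<lambda>i. \<eta> k (Inl i) b) b = 0"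
  using inhomogeneous(3)[OF assms] pi_pderiv[OF assms(1)] P_space[OF assms] U_point(3)[OF assms(1)]
  by simp

lemma eta_base:
  assumes "b \<in> U" "k \<noteq> ct"
  shows "\<eta> k (Inl i) b = pderiv_at (Inl i) (\<Lambda> k ct) b
    + along_flow (\<lambda>m. pderiv_at (Inl i) (\<Lambda> k m) b) b - b $ Inr (vel k) * pderiv_at (Inl i) \<tau> b"
proof -
  have "\<eta> k (Inl i) b = pderiv_at (Inl i) (\<lambda>b. \<Lambda> k ct b
      + along_flow (\<lambda>i. \<Lambda> k i b) b - b $ Inr (vel k) * \<tau> b) b"
    using pderiv_cong[OF assms(1) eta_eq[OF _ assms(2)]] by (simp add: DX_def)
  with assms show ?thesis by (simp add: pderiv_at_arith pderiv_along_flow)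
qed

text \<open>All \<open>\<Lambda> k k\<close> agree by \<open>diagonal\<close>, and commuting
  derivatives turns the k-derivative of \<open>\<Lambda> k m\<close> into the m-derivative of that
  common entry.\<close>

lemma eta_div:
  assumes "b \<in> U" "k \<noteq> ct"
  shows "\<eta> k (Inl k) b = pderiv_at (Inl ct) (\<Lambda> cx cx) b
    + along_flow (\<lambda>m. pderiv_at (Inl m) (\<Lambda> cx cx) b) b"
proof -
  have "pderiv_at (Inl k) (\<Lambda> k m) b = pderiv_at (Inl m) (\<Lambda> cx cx) b" for m
  proof -
    have "pderiv_at (Inl k) (\<Lambda> k m) b = pderiv_at (Inl m) (\<Lambda> k k) b"
      by (rule DX_commute[OF assms(1)])
    also have "\<dots> = pderiv_at (Inl m) (\<Lambda> cx cx) b"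
      by (rule pderiv_cong[OF assms(1) diagonal[OF _ assms(2)]])
    finally show ?thesis .
  qed
  then show ?thesis using eta_base[OF assms, of k] X_time2[OF assms(1)] assms(2) by simp
qed

lemma pressure_flow:
  assumes "b \<in> U"
  shows "pderiv_at (Inl ct) P b + 3 * \<gamma> * (pderiv_at (Inl ct) (\<Lambda> cx cx) b
    + along_flow (\<lambda>m. pderiv_at (Inl m) (\<Lambda> cx cx) b) b) = 0" (is "?P + 3 * \<gamma> * ?L = 0")
proof -
  have "along_flow (\<lambda>i. DX (Inr cp) (Inl i) b) b = along_flow (\<lambda>i. 0) b"
    using assms by (intro along_flow_cong) (simp add: pi_pderiv P_space)
  then have "b $ Inr cp * ?P + \<gamma> * b $ Inr cp * (3 * ?L) = 0"
    using inhomogeneous(2)[OF assms] eta_div[OF assms, of cx] eta_div[OF assms, of cy]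
      eta_div[OF assms, of cz] pi_pderiv[OF assms, of ct] by simp
  then have "b $ Inr cp * (?P + 3 * \<gamma> * ?L) = 0" by (simp add: algebra_simps)
  with U_point(2)[OF assms] show ?thesis by simp
qed

text \<open>\<open>pressure_flow\<close> is affine in the velocities, and its m-th coefficient is
  3\<gamma> times this derivative, with \<gamma> nonzero.\<close>

lemma dilation_space:
  assumes "b \<in> U" "m \<noteq> ct"
  shows "pderiv_at (Inl m) (\<Lambda> cx cx) b = 0"
proof -
  have "pderiv_at (Inr (vel m)) (\<lambda>b. pderiv_at (Inl ct) P b + 3 * \<gamma> *
      (pderiv_at (Inl ct) (\<Lambda> cx cx) b + along_flow (\<lambda>m. pderiv_at (Inl m) (\<Lambda> cx cx) b) b)) b = 0"
    by (rule pderiv_zero[OF assms(1) pressure_flow])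
  then show ?thesis
    using assms \<gamma> by (simp add: pderiv_at_arith pderiv_along_flow DDX_zero pi_p2 X_dep2)
qed

lemma pressure_time:
  assumes "b \<in> U"
  shows "pderiv_at (Inl ct) P b + 3 * \<gamma> * pderiv_at (Inl ct) (\<Lambda> cx cx) b = 0"
proof -
  have "along_flow (\<lambda>m. pderiv_at (Inl m) (\<Lambda> cx cx) b) b = along_flow (\<lambda>i. 0) b"
    using assms by (intro along_flow_cong dilation_space)
  with pressure_flow[OF assms] show ?thesis by simp
qed

lemma rho_base:
  assumes "b \<in> U"
  shows "DX (Inr cq) (Inl i) b = b $ Inr cq * (2 * pderiv_at (Inl i) \<tau> b + pderiv_at (Inl i) P b
    - 2 * pderiv_at (Inl i) (\<Lambda> cx cx) b)"
proof -
  have "DX (Inr cq) (Inl i) b =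
      pderiv_at (Inl i) (\<lambda>b. b $ Inr cq * (2 * \<tau> b + P b - 2 * \<Lambda> cx cx b)) b"
    using pderiv_cong[OF assms rho_eq] by (simp add: DX_def)
  with assms show ?thesis by (simp add: pderiv_at_arith)
qed

text \<open>The density coefficient contributes -2 and the divergence +3 times the derivative of
  \<open>\<Lambda> cx cx\<close>.\<close>

lemma density_time:
  assumes "b \<in> U"
  shows "2 * pderiv_at (Inl ct) \<tau> b + pderiv_at (Inl ct) P b + pderiv_at (Inl ct) (\<Lambda> cx cx) b = 0"
    (is "?e = 0")
proof -
  have 1: "along_flow (\<lambda>m. pderiv_at (Inl m) (\<Lambda> cx cx) b) b = along_flow (\<lambda>i. 0) b"
    using assms by (intro along_flow_cong dilation_space)
  have "along_flow (\<lambda>i. DX (Inr cq) (Inl i) b) b = along_flow (\<lambda>i. 0) b"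
    using assms by (intro along_flow_cong) (simp add: rho_base P_space dilation_space X_time2)
  then have "b $ Inr cq * ?e = 0"
    using inhomogeneous(1)[OF assms] eta_div[OF assms, of cx] eta_div[OF assms, of cy]
      eta_div[OF assms, of cz] rho_base[OF assms, of ct] 1 by (simp add: algebra_simps)
  with U_point(3)[OF assms] show ?thesis by simp
qed

lemma eta_mixed:
  assumes "b \<in> U" "k \<noteq> ct" "m \<noteq> ct"
  shows "pderiv_at (Inr (vel m)) (\<eta> k (Inl i)) b =
    pderiv_at (Inl i) (\<Lambda> k m) b - of_bool (k = m) * pderiv_at (Inl i) \<tau> b"
proof -
  have "pderiv_at (Inr (vel m)) (\<eta> k (Inl i)) b = pderiv_at (Inl i) (\<eta> k (Inr (vel m))) b"
    by (rule DX_commute[OF assms(1)])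
  also have "\<dots> = pderiv_at (Inl i) (\<lambda>b. \<Lambda> k m b - of_bool (k = m) * \<tau> b) b"
    by (rule pderiv_cong[OF assms(1) eta_vel[OF _ assms(2,3)]])
  finally show ?thesis using assms by (simp add: pderiv_at_arith)
qed

text \<open>Differentiate \<open>eta_flow\<close> in the m-th velocity: the mixed derivatives and
  the product-rule term \<open>\<eta> k (Inl m)\<close> contribute equally, whence the factors
  2.\<close>

lemma rotation_flow:
  assumes "b \<in> U" "k \<noteq> ct" "m \<noteq> ct"
  shows "2 * pderiv_at (Inl ct) (\<Lambda> k m) b - of_bool (k = m) * pderiv_at (Inl ct) \<tau> b
    + 2 * along_flow (\<lambda>i. pderiv_at (Inl i) (\<Lambda> k m) b) b = 0"
proof -
  have "pderiv_at (Inr (vel m)) (\<lambda>b. \<eta> k (Inl ct) b + along_flow (\<lambda>i. \<eta> k (Inl i) b) b) b = 0"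
    by (rule pderiv_zero[OF assms(1) eta_flow[OF _ assms(2)]])
  moreover have "along_flow (\<lambda>i. pderiv_at (Inr (vel m)) (\<eta> k (Inl i)) b) b =
      along_flow (\<lambda>i. pderiv_at (Inl i) (\<Lambda> k m) b) b"
    using assms by (intro along_flow_cong) (simp add: eta_mixed X_time2)
  moreover have "along_flow (\<lambda>i. pderiv_at (Inl m) (\<Lambda> k i) b) b =
      along_flow (\<lambda>i. pderiv_at (Inl i) (\<Lambda> k m) b) b"
    by (intro along_flow_cong DX_commute[OF assms(1)])
  moreover have "pderiv_at (Inl m) (\<Lambda> k ct) b = pderiv_at (Inl ct) (\<Lambda> k m) b"
    by (rule DX_commute[OF assms(1)])
  ultimately show ?thesis
    using assms eta_base[OF assms(1,2), of m]
    by (simp add: pderiv_at_arith pderiv_along_flow eta_mixed X_time2)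
qed

lemma rotation_space:
  assumes "b \<in> U" "k \<noteq> ct" "m \<noteq> ct" "i \<noteq> ct"
  shows "pderiv_at (Inl i) (\<Lambda> k m) b = 0"
proof -
  have "pderiv_at (Inr (vel i)) (\<lambda>b. 2 * pderiv_at (Inl ct) (\<Lambda> k m) b
      - of_bool (k = m) * pderiv_at (Inl ct) \<tau> b
      + 2 * along_flow (\<lambda>i. pderiv_at (Inl i) (\<Lambda> k m) b) b) b = 0"
    by (rule pderiv_zero[OF assms(1) rotation_flow[OF _ assms(2,3)]])
  then show ?thesis
    using assms by (simp add: pderiv_at_arith pderiv_along_flow DDX_zero X_dep2)
qed

lemma rotation_time:
  assumes "b \<in> U" "k \<noteq> ct" "m \<noteq> ct"
  shows "2 * pderiv_at (Inl ct) (\<Lambda> k m) b = of_bool (k = m) * pderiv_at (Inl ct) \<tau> b"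
proof -
  have "along_flow (\<lambda>i. pderiv_at (Inl i) (\<Lambda> k m) b) b = along_flow (\<lambda>i. 0) b"
    using assms by (intro along_flow_cong rotation_space)
  with rotation_flow[OF assms] show ?thesis by simp
qed

section \<open>Vanishing of all second derivatives\<close>

context
  assumes \<gamma>': "\<gamma> \<noteq> 5 / 3"
begin

text \<open>With l the time derivative of \<open>\<Lambda> cx cx\<close>, those of \<tau> and
  \<open>P\<close> are 2l and -5l, while \<open>pressure_time\<close> gives -3\<gamma> l for the
  latter. At \<gamma> = 5/3 these relations would leave l free.\<close>

lemma scaling_time:
  assumes "b \<in> U"
  shows "pderiv_at (Inl ct) \<tau> b = 0" "pderiv_at (Inl ct) P b = 0"
proof -
  let ?l = "pderiv_at (Inl ct) (\<Lambda> cx cx) b"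
  have 1: "2 * ?l = pderiv_at (Inl ct) \<tau> b"
    using rotation_time[OF assms, of cx cx] by simp
  then have "pderiv_at (Inl ct) P b = - 5 * ?l"
    using density_time[OF assms] by linarith
  then have "(5 - 3 * \<gamma>) * ?l = 0"
    using pressure_time[OF assms] by (simp add: algebra_simps)
  then have "?l = 0" using \<gamma>' by simp
  with 1 pressure_time[OF assms] show "pderiv_at (Inl ct) \<tau> b = 0" "pderiv_at (Inl ct) P b = 0"
    by simp_all
qed

lemma \<tau>_const: "b \<in> U \<Longrightarrow> pderiv_at a \<tau> b = 0"
  using X_time2[of b a] scaling_time(1)[of b] by (cases "a = Inl ct") auto

lemma P_const: "b \<in> U \<Longrightarrow> pderiv_at a P b = 0"
  using P_space[of b] scaling_time(2)[of b] pi_p2[of b]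
  by (cases a; cases "a = Inl ct") auto

lemma \<Lambda>_const:
  assumes "b \<in> U" "k \<noteq> ct"
  shows "m \<noteq> ct \<Longrightarrow> pderiv_at a (\<Lambda> k m) b = 0" "pderiv_at a (\<Lambda> k ct) b = 0"
proof -
  show 1: "pderiv_at a (\<Lambda> k m) b = 0" if "m \<noteq> ct" for a m
  proof (cases a)
    case (Inl i)
    then show ?thesis
      using rotation_space[OF assms that, of i] rotation_time[OF assms that] scaling_time(1)[OF assms(1)]
      by (cases "i = ct") auto
  qed (simp add: X_dep2 assms)
  show "pderiv_at a (\<Lambda> k ct) b = 0"
  proof (cases a)
    case (Inl i)
    show ?thesis
    proof (cases "i = ct")
      case False
      then show ?thesis
        using DX_commute[OF assms(1), of "Inl i" "Inl k" "Inl ct"] 1[OF False] Inl by simp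
    next
      case True
      \<comment> \<open>With the transport terms gone, \<open>eta_flow\<close> says that the second
        time derivative of the k-th spatial coefficient vanishes.\<close>
      have "along_flow (\<lambda>i. \<eta> k (Inl i) b) b = along_flow (\<lambda>i. 0) b"
      proof (rule along_flow_cong)
        fix i assume i: "i \<noteq> ct"
        have "along_flow (\<lambda>m. pderiv_at (Inl i) (\<Lambda> k m) b) b = along_flow (\<lambda>m. 0) b"
          by (rule along_flow_cong) (rule 1)
        then show "\<eta> k (Inl i) b = 0"
          using eta_base[OF assms, of i] \<tau>_const[OF assms(1)] 1[OF i]
            DX_commute[OF assms(1), of "Inl i" "Inl k" "Inl ct"] by simp
      qed
      moreover have "along_flow (\<lambda>m. pderiv_at (Inl ct) (\<Lambda> k m) b) b = along_flow (\<lambda>m. 0) b"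
        by (rule along_flow_cong) (rule 1)
      ultimately show ?thesis
        using eta_flow[OF assms] eta_base[OF assms, of ct] \<tau>_const[OF assms(1)] True Inl by simp
    qed
  qed (simp add: X_dep2 assms)
qed

lemma eta_base_zero:
  assumes "b \<in> U" "k \<noteq> ct"
  shows "\<eta> k (Inl i) b = 0"
proof -
  have "along_flow (\<lambda>m. pderiv_at (Inl i) (\<Lambda> k m) b) b = along_flow (\<lambda>m. 0) b"
    using assms by (intro along_flow_cong \<Lambda>_const(1))
  then show ?thesis
    using eta_base[OF assms, of i] \<tau>_const[OF assms(1)] \<Lambda>_const[OF assms] by simp
qed

lemma rho_q:
  assumes "b \<in> U"
  shows "DX (Inr cq) (Inr cq) b = 2 * \<tau> b + P b - 2 * \<Lambda> cx cx b"
    and "a \<noteq> Inr cq \<Longrightarrow> DX (Inr cq) a b = 0"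
proof -
  have "DX (Inr cq) a b =
      pderiv_at a (\<lambda>b. b $ Inr cq * (2 * \<tau> b + P b - 2 * \<Lambda> cx cx b)) b" for a
    using pderiv_cong[OF assms rho_eq] by (simp add: DX_def)
  then have "DX (Inr cq) a b = of_bool (Inr cq = a) * (2 * \<tau> b + P b - 2 * \<Lambda> cx cx b)" for a
    using assms by (simp add: pderiv_at_arith \<tau>_const P_const \<Lambda>_const)
  then show "DX (Inr cq) (Inr cq) b = 2 * \<tau> b + P b - 2 * \<Lambda> cx cx b"
    and "a \<noteq> Inr cq \<Longrightarrow> DX (Inr cq) a b = 0" by simp_all
qed

lemma pi_other: "b \<in> U \<Longrightarrow> a \<noteq> Inr cp \<Longrightarrow> DX (Inr cp) a b = 0"
  by (cases a) (auto simp: pi_pderiv P_const pi_dep)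

lemma second_derivative_zero:
  assumes "b \<in> U"
  shows "pderiv_at a (DX c d) b = 0"
proof (cases c)
  case (Inl k)
  show ?thesis
  proof (cases d)
    case (Inl m)
    show ?thesis
      unfolding \<open>c = Inl k\<close> Inl
      using \<tau>_const[OF assms] \<Lambda>_const[OF assms] DX_zero2(1)[OF assms X_time]
      by (cases "k = ct"; cases "m = ct") auto
  next
    case (Inr e)
    show ?thesis
      unfolding \<open>c = Inl k\<close> Inr by (rule DX_zero2(1)[OF assms X_dep])
  qed
next
  case (Inr e)
  then show ?thesis
  proof (cases e rule: vel_cases)
    case (vel k)
    show ?thesis
    proof (cases d)
      case (Inl i)
      show ?thesis
        unfolding \<open>c = Inr e\<close> vel Inl by (rule DX_zero2(1)[OF assms eta_base_zero[OF _ vel(1)]])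
    next
      case (Inr e')
      show ?thesis
      proof (cases e' rule: vel_cases)
        case (vel m)
        have "pderiv_at a (\<eta> k (Inr (vel m))) b =
            pderiv_at a (\<lambda>b. \<Lambda> k m b - of_bool (k = m) * \<tau> b) b"
          by (rule pderiv_cong[OF assms eta_vel[OF _ \<open>k \<noteq> ct\<close> vel(1)]])
        also have "\<dots> = 0"
          using assms vel \<open>k \<noteq> ct\<close> by (simp add: pderiv_at_arith \<tau>_const \<Lambda>_const)
        finally show ?thesis
          using \<open>c = Inr e\<close> \<open>e = vel k\<close> Inr vel by simp
      next
        case p
        show ?thesis
          unfolding \<open>c = Inr e\<close> \<open>e = vel k\<close> Inr p by (rule DX_zero2(1)[OF assms eta_p[OF _ vel(1)]])
      next
        case q
        show ?thesis
          unfolding \<open>c = Inr e\<close> \<open>e = vel k\<close> Inr q by (rule DX_zero2(1)[OF assms eta_q[OF _ vel(1)]])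
      qed
    qed
  next
    case p
    show ?thesis
      unfolding Inr p using P_const[OF assms] DX_zero2(1)[OF assms pi_other]
      by (cases "d = Inr cp") auto
  next
    case q
    have "pderiv_at a (DX (Inr cq) (Inr cq)) b = pderiv_at a (\<lambda>b. 2 * \<tau> b + P b - 2 * \<Lambda> cx cx b) b"
      by (rule pderiv_cong[OF assms rho_q(1)])
    also have "\<dots> = 0"
      using assms by (simp add: pderiv_at_arith \<tau>_const P_const \<Lambda>_const)
    finally show ?thesis
      unfolding Inr q using DX_zero2(1)[OF assms rho_q(2)]
      by (cases "d = Inr cq") auto
  qed
qed

end

section \<open>Extension to \<open>M\<close> and identification of the 13 parameters\<close>

lemma U_dense:
  assumes "open W" "W \<subseteq> M" "b \<in> W"
  shows "\<exists>x\<in>W. x \<in> U"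
proof -
  obtain e where e: "e > 0" "ball b e \<subseteq> W" using assms(1,3) openE by blast
  \<comment> \<open>Two values of \<open>s\<close> must be avoided. The direction used below has
    norm at most 2, so \<open>s < e / 2\<close> stays in the ball.\<close>
  have "infinite ({0<..<e / 2} - {- b $ Inr cp, - b $ Inr cq})"
    using e(1) by (intro Diff_infinite_finite) (simp_all add: infinite_Ioo)
  then obtain s where "s \<in> {0<..<e / 2} - {- b $ Inr cp, - b $ Inr cq}"
    using infinite_imp_nonempty by blast
  then have s: "0 < s" "s < e / 2" "s \<noteq> - b $ Inr cp" "s \<noteq> - b $ Inr cq" by auto
  define x where "x = b + s *\<^sub>R (axis (Inr cp) 1 + axis (Inr cq) 1)"
  have "norm (axis (Inr cp) 1 + axis (Inr cq) 1 :: euler_point) \<le> 2"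
    by (rule order_trans[OF norm_triangle_ineq]) simp
  then have "dist b x \<le> s * 2"
    using s(1) by (simp add: x_def dist_norm mult_left_mono)
  then have "x \<in> W" using s(2) e(2) by (intro subsetD[OF e(2)]) simp
  moreover have "x $ Inr cp \<noteq> 0" "x $ Inr cq \<noteq> 0"
    using s(3,4) by (auto simp: x_def axis_def add_eq_0_iff)
  ultimately show ?thesis using assms(2) by (auto simp: U_def)
qed

lemma zero_on_M:
  fixes f :: "euler_point \<Rightarrow> real"
  assumes "continuous_on M f" "\<And>x. x \<in> U \<Longrightarrow> f x = 0" "b \<in> M"
  shows "f b = 0"
proof (rule ccontr)
  assume "f b \<noteq> 0"
  have "open (f -` (- {0}) \<inter> M)"
    using continuous_open_preimage[OF assms(1) M open_Compl[OF closed_singleton]] by (simp add: Int_commute)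
  with \<open>f b \<noteq> 0\<close> assms(3) obtain x where "x \<in> f -` (- {0}) \<inter> M" "x \<in> U"
    using U_dense[of "f -` (- {0}) \<inter> M" b] by auto
  with assms(2) show False by auto
qed

lemma smooth_DX_M: "smooth_on M (DX c a)"
  unfolding DX_def by (rule smooth_on_pderiv[OF smooth_X])

text \<open>The constancy arguments run on the connected set \<open>M\<close>, since the hyperplanes
  p = 0 and q = 0 may disconnect \<open>U\<close>; \<open>zero_on_M\<close> first extends the
  vanishing of second derivatives.\<close>

lemma affine:
  assumes "connected M" "\<gamma> \<noteq> 5 / 3" "b \<in> M" "x \<in> M"
  shows "X x $ c = X b $ c + (\<Sum>a\<in>UNIV. DX c a b * (x $ a - b $ a))"
proof -
  have "pderiv_at a' (DX c a) y = 0" if "y \<in> M" for a' a y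
    using smooth_on_continuous[OF smooth_on_pderiv[OF smooth_DX_M]] second_derivative_zero[OF assms(2)] that
    by (rule zero_on_M)
  then have const: "DX c a y = DX c a b" if "y \<in> M" for a y
    using that assms smooth_on_differentiable[OF smooth_DX_M]
    by (intro constant_if_pderiv_zero[OF M]) auto
  let ?l = "\<lambda>y. \<Sum>a\<in>UNIV. DX c a b * y $ a"
  have "bounded_linear ?l"
    unfolding linear_conv_bounded_linear[symmetric]
    by (rule linearI) (simp_all add: algebra_simps sum.distrib sum_distrib_left)
  then have l: "(?l has_derivative ?l) (at y)" for y
    by (rule bounded_linear_imp_has_derivative)
  have X_diff: "(\<lambda>y. X y $ c) differentiable at y" if "y \<in> M" for y
    using smooth_on_differentiable[OF smooth_X that] .
  have l_diff: "?l differentiable at y" for y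
    using l by (auto simp: differentiable_def)
  have "X x $ c - ?l x = X b $ c - ?l b"
  proof (rule constant_if_pderiv_zero[OF M assms(1) _ _ assms(4,3)])
    fix y assume y: "y \<in> M"
    show "(\<lambda>y. X y $ c - ?l y) differentiable at y"
      using X_diff[OF y] l_diff by (rule differentiable_diff)
    fix a
    have "pderiv_at a ?l y = DX c a b"
      by (simp add: pderiv_at_has_derivative[OF l] axis_def if_distrib cong: if_cong)
    moreover have "pderiv_at a (\<lambda>y. X y $ c) y = DX c a b"
      using const[OF y, of a] by (simp add: DX_def)
    moreover have "pderiv_at a (\<lambda>y. X y $ c - ?l y) y =
        pderiv_at a (\<lambda>y. X y $ c) y - pderiv_at a ?l y"
      by (rule pderiv_at_diff[OF X_diff[OF y] l_diff])
    ultimately show "pderiv_at a (\<lambda>y. X y $ c - ?l y) y = 0" by simp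
  qed
  then show ?thesis by (simp add: right_diff_distrib sum_subtractf)
qed

lemma symmetry_is_comb:
  assumes "connected M" "M \<noteq> {}" "\<gamma> \<noteq> 5 / 3"
  shows "X \<in> range (euler_comb M)"
proof -
  obtain b where b: "b \<in> U" "b \<in> M"
    using assms(2) U_dense[OF M] by (auto simp: U_def)
  define K where "K c = X b $ c - (\<Sum>a\<in>UNIV. DX c a b * b $ a)" for c
  have X_eq: "X x $ c = (\<Sum>a\<in>UNIV. DX c a b * x $ a) + K c" if "x \<in> M" for x c
    using affine[OF assms(1,3) b(2) that, of c]
    by (simp add: K_def right_diff_distrib sum_subtractf)
  \<comment> \<open>Parameters read off from the constant and linear parts; the signs at 11 and 12
    come from the terms with -z in these generators.\<close>
  define C where "C i = [K (Inl cx), K (Inl cy), K (Inl cz), K (Inl ct),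
    \<Lambda> cx ct b, \<Lambda> cy ct b, \<Lambda> cz ct b, \<tau> b, \<Lambda> cx cx b, \<Lambda> cx cy b, - \<Lambda> cy cz b, - \<Lambda> cx cz b, P b] ! (i - 1)"
    for i :: nat
  have eta_vel': "DX (Inr cu) (Inr cu) b = \<Lambda> cx cx b - \<tau> b" "DX (Inr cv) (Inr cv) b = \<Lambda> cy cy b - \<tau> b"
    "DX (Inr cw) (Inr cw) b = \<Lambda> cz cz b - \<tau> b"
    "DX (Inr cu) (Inr cv) b = \<Lambda> cx cy b" "DX (Inr cu) (Inr cw) b = \<Lambda> cx cz b"
    "DX (Inr cv) (Inr cu) b = \<Lambda> cy cx b" "DX (Inr cv) (Inr cw) b = \<Lambda> cy cz b"
    "DX (Inr cw) (Inr cu) b = \<Lambda> cz cx b" "DX (Inr cw) (Inr cv) b = \<Lambda> cz cy b"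
    using eta_vel[OF b(1), of cx cx] eta_vel[OF b(1), of cy cy] eta_vel[OF b(1), of cz cz]
      eta_vel[OF b(1), of cx cy] eta_vel[OF b(1), of cx cz] eta_vel[OF b(1), of cy cx]
      eta_vel[OF b(1), of cy cz] eta_vel[OF b(1), of cz cx] eta_vel[OF b(1), of cz cy]
    by simp_all
  have eta_other: "DX (Inr d) a b = 0"
    if "d \<in> {cu, cv, cw}" "a \<notin> {Inr cu, Inr cv, Inr cw}" for d a
  proof -
    have "d = vel cx \<or> d = vel cy \<or> d = vel cz" using that(1) by auto
    then obtain k where "k \<noteq> ct" "d = vel k"
      by (metis euler_indep.distinct(1,3,5))
    then show ?thesis
      using that(2) eta_base_zero[OF assms(3) b(1)] eta_p[OF b(1)] eta_q[OF b(1)]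
      by (cases a; cases "projr a") auto
  qed
  have conf: "\<Lambda> cy cy b = \<Lambda> cx cx b" "\<Lambda> cz cz b = \<Lambda> cx cx b"
    "\<Lambda> cy cx b = - \<Lambda> cx cy b" "\<Lambda> cz cx b = - \<Lambda> cx cz b" "\<Lambda> cz cy b = - \<Lambda> cy cz b"
    using diagonal[OF b(1), of cy] diagonal[OF b(1), of cz]
      conformal[OF b(1), of cy cx] conformal[OF b(1), of cz cx] conformal[OF b(1), of cz cy]
    by simp_all
  note vals = X_dep[OF b(1)] X_time[OF b(1)] eta_vel' eta_other conf pi_other[OF assms(3) b(1)]
    rho_q[OF assms(3) b(1)] UNIV_euler_coord
  \<comment> \<open>Comparing \<open>eta_eq\<close> at \<open>b\<close> with the affine form shows
    that the velocity constants are the boost coefficients; pressure and density have no constant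
    part.\<close>
  have K: "K (Inr cu) = \<Lambda> cx ct b" "K (Inr cv) = \<Lambda> cy ct b" "K (Inr cw) = \<Lambda> cz ct b"
    "K (Inr cp) = 0" "K (Inr cq) = 0"
    using eta_eq[OF b(1), of cx] eta_eq[OF b(1), of cy] eta_eq[OF b(1), of cz]
      pi_eq[OF b(1)] rho_eq[OF b(1)]
    by (simp_all add: K_def vals along_flow_def algebra_simps)
  have "X x $ c = euler_comb M C x $ c" if "x \<in> M" for x c
    by (induction c rule: euler_coord_cases)
      (simp_all add: X_eq[OF that] euler_comb_nth[OF that] C_def vals K algebra_simps)
  moreover have "X x = euler_comb M C x" if "x \<notin> M" for x
    using X that by (simp add: euler_symmetries_def infinitesimal_symmetries_def euler_comb_def on_domain_def)
  ultimately have "X = euler_comb M C"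
    by (auto simp: fun_eq_iff vec_eq_iff)
  then show ?thesis by simp
qed

end

theorem theorem1:
  fixes \<gamma> :: real and M :: "euler_point set"
  assumes "open M" and "connected M" and "M \<noteq> {}"
  shows "(\<forall>i\<in>{1..13}. euler_generator M i \<in> euler_symmetries \<gamma> M) \<and>
    (\<gamma> \<noteq> 0 \<and> \<gamma> \<noteq> 5/3 \<longrightarrow>
       euler_symmetries \<gamma> M = vf.span (euler_generator M ` {1..13})) \<and>
    generate_euler_algebra M (euler_generator M :: nat \<Rightarrow> real euler_vfield) \<and>
    generate_euler_algebra M (euler_generator M :: nat \<Rightarrow> complex euler_vfield)"
proof (intro conjI ballI impI)
  show "euler_generator M i \<in> euler_symmetries \<gamma> M" if "i \<in> {1..13}" for i
    by (simp only: euler_generator_eq_comb[OF that] euler_comb_in_symmetries[OF assms(1)])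
  show "euler_symmetries \<gamma> M = vf.span (euler_generator M ` {1..13})"
    if \<gamma>_neq: "\<gamma> \<noteq> 0 \<and> \<gamma> \<noteq> 5/3"
    unfolding span_euler_generators
  proof
    show "euler_symmetries \<gamma> M \<subseteq> range (euler_comb M)"
    proof
      fix X assume "X \<in> euler_symmetries \<gamma> M"
      then interpret euler_symmetry \<gamma> M X
        using assms(1) \<gamma>_neq by unfold_locales auto
      show "X \<in> range (euler_comb M)"
        using symmetry_is_comb assms(2,3) \<gamma>_neq by blast
    qed
    show "range (euler_comb M) \<subseteq> euler_symmetries \<gamma> M"
      using euler_comb_in_symmetries[OF assms(1)] by blast
  qed
qed (rule generate_euler_algebra[OF assms(1,3)])+

end
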